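(* For each positive integer $r$, let $\mathcal{H}_r=\{C_3,C_5,\ldots,C_{2r+1}\}$ be the family of odd cycles of length at most $2r+1$. For positive integers $n \ge k \ge 1$ and $r \ge 1$, $$h(n, k, C_{2r+1}) = h(n, k, \mathcal{H}_r) + O_r(n^{3/2}).$$ In particular, $$h(n, k, C_{2r+1}) = O_r\left(\frac{n^2}{k^{r+1}}\right).$$ That is, for each $r \geq 1$ there is a constant $A_r$ depending only on $r$ such that for all integers $n \geq k \geq 1$ both $|h(n,k,C_{2r+1}) - h(n,k,\mathcal{H}_r)| \le A_r n^{3/2}$ and $h(n,k,C_{2r+1}) \le A_r n^2/k^{r+1}$ hold.
   Context: All graphs are finite, undirected and simple. A graph is $H$-free if it does not contain $H$ as a (not necessarily induced) subgraph; for a family $\mathcal{H}$ of graphs, a graph is $\mathcal{H}$-free if it contains no member of $\mathcal{H}$ as a subgraph. For a graph $G$ and a positive integer $k$, $h(G,k)$ is the minimum number of edges that can be deleted from $G$ so that the remaining graph is $k$-colorable. For positive integers $n,k$, $h(n,k,H)$ (respectively $h(n,k,\mathcal{H})$) is the maximum of $h(G,k)$ over all $H$-free (respectively $\mathcal{H}$-free) graphs $G$ on $n$ vertices. $C_\ell$ is the cycle of length $\ell$. The notation $O_r$ indicates that the implicit constant depends only on $r$. *)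

theory Defs
  imports Complex_Main
begin

type_synonym 'a ugraph = "'a set \<times> 'a set set"

abbreviation verts :: "'a ugraph \<Rightarrow> 'a set" where
  "verts G \<equiv> fst G"

abbreviation edges :: "'a ugraph \<Rightarrow> 'a set set" where
  "edges G \<equiv> snd G"

definition simple_graph :: "'a ugraph \<Rightarrow> bool" where
  "simple_graph G \<longleftrightarrow> finite (verts G) \<and> (\<forall>e\<in>edges G. e \<subseteq> verts G \<and> card e = 2)"

text \<open>Containment as a not necessarily induced subgraph: a copy of \<open>H\<close> in \<open>G\<close> is an injective
  map on vertices that sends edges to edges.\<close>

definition contains_copy :: "'a ugraph \<Rightarrow> 'b ugraph \<Rightarrow> bool" where
  "contains_copy G H \<longleftrightarrow>
     (\<exists>f. inj_on f (verts H) \<and> f ` verts H \<subseteq> verts G \<and> (\<forall>e\<in>edges H. f ` e \<in> edges G))"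

definition free_of :: "'b ugraph set \<Rightarrow> 'a ugraph \<Rightarrow> bool" where
  "free_of \<H> G \<longleftrightarrow> (\<forall>H\<in>\<H>. \<not> contains_copy G H)"

definition colorable :: "nat \<Rightarrow> 'a ugraph \<Rightarrow> bool" where
  "colorable k G \<longleftrightarrow>
     (\<exists>c :: 'a \<Rightarrow> nat. (\<forall>v\<in>verts G. c v < k) \<and> (\<forall>u v. {u, v} \<in> edges G \<longrightarrow> c u \<noteq> c v))"

text \<open>The set below is nonempty for a simple graph and \<open>k \<ge> 1\<close>, since all edges may be deleted.\<close>

definition h_graph :: "'a ugraph \<Rightarrow> nat \<Rightarrow> nat" where
  "h_graph G k = Min {card F | F. F \<subseteq> edges G \<and> colorable k (verts G, edges G - F)}"

text \<open>Every finite graph is isomorphic to one whose vertices are natural numbers, so these suffice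
  for the maximum. A single forbidden graph \<open>H\<close> is the family \<open>{H}\<close>.\<close>

definition h_values :: "nat \<Rightarrow> nat \<Rightarrow> 'b ugraph set \<Rightarrow> nat set" where
  "h_values n k \<H> =
     {h_graph G k | G :: nat ugraph. simple_graph G \<and> card (verts G) = n \<and> free_of \<H> G}"

definition h_max :: "nat \<Rightarrow> nat \<Rightarrow> 'b ugraph set \<Rightarrow> nat" where
  "h_max n k \<H> = Max (h_values n k \<H>)"

text \<open>This is a simple cycle only for \<open>l \<ge> 3\<close>, the only lengths used.\<close>

definition cycle_graph :: "nat \<Rightarrow> nat ugraph" where
  "cycle_graph l = ({..<l}, {{i, (i + 1) mod l} | i. i < l})"

definition odd_cycles_upto :: "nat \<Rightarrow> nat ugraph set" where
  "odd_cycles_upto r = {cycle_graph (2 * i + 1) | i. 1 \<le> i \<and> i \<le> r}"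

text \<open>Both extrema above are taken over finite nonempty sets, hence attained.\<close>

lemma finite_edges: "simple_graph G \<Longrightarrow> finite (edges G)"
  unfolding simple_graph_def by (meson PowI finite_Pow_iff finite_subset subsetI)

lemma h_graph_attained:
  assumes "simple_graph G" "k \<ge> 1"
  shows "\<exists>F. F \<subseteq> edges G \<and> colorable k (verts G, edges G - F) \<and> card F = h_graph G k"
    and "\<And>F. F \<subseteq> edges G \<Longrightarrow> colorable k (verts G, edges G - F) \<Longrightarrow> h_graph G k \<le> card F"
proof -
  let ?S = "{card F | F. F \<subseteq> edges G \<and> colorable k (verts G, edges G - F)}"
  have fin: "finite ?S"
    using finite_edges[OF assms(1)] by auto
  have "colorable k (verts G, edges G - edges G)"
    unfolding colorable_def using assms(2) by (auto intro!: exI[of _ "\<lambda>_. 0"])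
  then have ne: "?S \<noteq> {}"
    by blast
  show "\<exists>F. F \<subseteq> edges G \<and> colorable k (verts G, edges G - F) \<and> card F = h_graph G k"
    using Min_in[OF fin ne] unfolding h_graph_def by auto
  show "h_graph G k \<le> card F" if "F \<subseteq> edges G" "colorable k (verts G, edges G - F)" for F
    unfolding h_graph_def using fin that by (intro Min_le) auto
qed

lemma finite_h_values:
  assumes "k \<ge> 1"
  shows "finite (h_values n k \<H>)"
proof -
  have "m \<le> 2 ^ n" if m: "m \<in> h_values n k \<H>" for m
  proof -
    obtain G :: "nat ugraph" where G: "simple_graph G" "card (verts G) = n" "m = h_graph G k"
      using m unfolding h_values_def by blast
    obtain F where F: "F \<subseteq> edges G" "card F = m"
      using h_graph_attained(1)[OF G(1) assms] G(3) by auto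
    have "finite (Pow (verts G))" "F \<subseteq> Pow (verts G)"
      using G(1) F(1) unfolding simple_graph_def by auto
    then have "card F \<le> card (Pow (verts G))"
      by (rule card_mono)
    also have "\<dots> = 2 ^ n"
      using G(1,2) by (simp add: card_Pow simple_graph_def)
    finally show ?thesis
      using F(2) by simp
  qed
  then show ?thesis
    by (meson finite_nat_set_iff_bounded_le)
qed

lemma h_values_nonempty:
  assumes "\<And>H. H \<in> \<H> \<Longrightarrow> edges H \<noteq> {}"
  shows "h_values n k \<H> \<noteq> {}"
proof -
  let ?G = "({..<n}, {}) :: nat ugraph"
  have "simple_graph ?G" "card (verts ?G) = n" "free_of \<H> ?G"
    using assms by (auto simp: simple_graph_def free_of_def contains_copy_def)
  then show ?thesis
    unfolding h_values_def by blast
qed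

end

theory Submission
  imports Defs "HOL-Analysis.Convex"
begin

text \<open>Difference of the two extremal functions: in a \<open>C\<^sub>2\<^sub>r\<^sub>+\<^sub>1\<close>-free graph, every family of edge-disjoint cycles
  of a shorter odd length \<open>2 * l + 1\<close> has \<open>O(n\<^sup>3\<^sup>/\<^sup>2)\<close> members, because otherwise one edge from each of
  them forms a bipartite graph dense enough to contain an even cycle that merges with one of the
  odd cycles into a \<open>C\<^sub>2\<^sub>r\<^sub>+\<^sub>1\<close>. Deleting the edges of a maximal family for each \<open>l < r\<close> destroys all
  short odd cycles.

  Upper bound: this is proved for \<open>C\<^sub>2\<^sub>r\<^sub>+\<^sub>1\<close>-free graphs directly, since the error \<open>n\<^sup>3\<^sup>/\<^sup>2\<close> exceeds
  \<open>n\<^sup>2 / k\<^sup>r\<^sup>+\<^sup>1\<close> for large \<open>k\<close>. Induct on the number \<open>N\<close> of vertices. An independent set of size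
  \<open>(r + 1) * N / k\<close> may be spent on one colour. If there is none, breadth-first layers up to depth \<open>r\<close>,
  which contain independent sets of a constant proportion, cannot keep expanding by a factor of
  order \<open>k\<close>; peeling off either vertices of degree \<open>O(N / k\<^sup>r)\<close> or balls that expand too slowly shows that
  half of the vertices form a graph of degeneracy \<open>O(N / k\<^sup>r)\<close>, which a constant fraction of the
  colours handles greedily.\<close>

section \<open>Cycles and increasing paths\<close>

definition cycle_edges :: "'a list \<Rightarrow> 'a set set" where
  "cycle_edges xs = (\<lambda>i. {xs ! i, xs ! (Suc i mod length xs)}) ` {..<length xs}"

definition cycle_in :: "'a set set \<Rightarrow> 'a list \<Rightarrow> bool" where
  "cycle_in E xs \<longleftrightarrow> distinct xs \<and> cycle_edges xs \<subseteq> E"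

definition indep :: "'a set set \<Rightarrow> 'a set \<Rightarrow> bool" where
  "indep E J \<longleftrightarrow> (\<forall>x\<in>J. \<forall>y\<in>J. {x, y} \<notin> E)"

text \<open>Cycles are assembled later by concatenating paths; \<open>successively\<close> splits
  over \<open>@\<close> and leaves a single closing edge to check.\<close>

lemma cycle_edges_conv:
  assumes "xs \<noteq> []"
  shows "cycle_edges xs \<subseteq> E \<longleftrightarrow> successively (\<lambda>x y. {x, y} \<in> E) xs \<and> {last xs, hd xs} \<in> E"
proof -
  obtain n where n: "length xs = Suc n" using assms by (cases xs) auto
  have "cycle_edges xs = insert {xs ! n, xs ! 0} ((\<lambda>i. {xs ! i, xs ! Suc i}) ` {..<n})"
    unfolding cycle_edges_def n lessThan_Suc by (auto simp: image_iff)
  then show ?thesis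
    using assms n by (auto simp: successively_conv_nth last_conv_nth hd_conv_nth)
qed

lemma card_cycle_edges: "card (cycle_edges xs) \<le> length xs"
  unfolding cycle_edges_def by (rule order_trans[OF card_image_le]) auto

lemma contains_copy_cycle:
  "contains_copy (V, E) (cycle_graph l) \<longleftrightarrow> (\<exists>xs. cycle_in E xs \<and> length xs = l \<and> set xs \<subseteq> V)"
proof
  assume "contains_copy (V, E) (cycle_graph l)"
  then obtain f where f: "inj_on f {..<l}" "f ` {..<l} \<subseteq> V"
    "\<forall>e\<in>{{i, (i + 1) mod l} | i. i < l}. f ` e \<in> E"
    unfolding contains_copy_def cycle_graph_def by auto
  have step: "{f i, f (Suc i mod l)} \<in> E" if "i < l" for i
    using f(3)[rule_format, of "{i, (i + 1) mod l}"] that by auto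
  let ?xs = "map f [0..<l]"
  have "cycle_in E ?xs" "length ?xs = l" "set ?xs \<subseteq> V"
    using f(1,2) step by (auto simp: cycle_in_def cycle_edges_def distinct_map atLeast0LessThan)
  then show "\<exists>xs. cycle_in E xs \<and> length xs = l \<and> set xs \<subseteq> V" by blast
next
  assume "\<exists>xs. cycle_in E xs \<and> length xs = l \<and> set xs \<subseteq> V"
  then obtain xs where xs: "cycle_in E xs" "length xs = l" "set xs \<subseteq> V" by blast
  then have "inj_on (\<lambda>i. xs ! i) {..<l}" "(\<lambda>i. xs ! i) ` {..<l} \<subseteq> V"
    "\<And>i. i < l \<Longrightarrow> (\<lambda>i. xs ! i) ` {i, (i + 1) mod l} \<in> E"
    by (auto simp: cycle_in_def cycle_edges_def inj_on_def nth_eq_iff_index_eq)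
  then show "contains_copy (V, E) (cycle_graph l)"
    unfolding contains_copy_def cycle_graph_def by (auto intro!: exI[of _ "\<lambda>i. xs ! i"])
qed

text \<open>Grade every vertex by the longest increasing \<open>R\<close>-path ending there. An
  increasing \<open>R\<close>-step raises the grade, so no grade class contains such a step. Without
  a path on \<open>m + 1\<close> vertices there are only \<open>m\<close> classes, and one of at
  least average size serves as \<open>J\<close>.\<close>

lemma increasing_path_or_antichain:
  fixes \<rho> :: "'a \<Rightarrow> 'b::order"
  assumes fin: "finite X"
  shows "(\<exists>xs. length xs = Suc m \<and> set xs \<subseteq> X \<and> successively R xs \<and> sorted_wrt (\<lambda>x y. \<rho> x < \<rho> y) xs)
       \<or> (\<exists>J\<subseteq>X. (\<forall>x\<in>J. \<forall>y\<in>J. \<rho> x < \<rho> y \<longrightarrow> \<not> R x y) \<and> card X \<le> m * card J)"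
proof -
  define P where "P q x xs \<longleftrightarrow> length xs = Suc q \<and> set xs \<subseteq> X \<and> successively R xs \<and>
    sorted_wrt (\<lambda>x y. \<rho> x < \<rho> y) xs \<and> last xs = x" for q x xs
  define A where "A q = {x. \<exists>xs. P q x xs}" for q
  show ?thesis
  proof (cases "A m = {}")
    case False
    then show ?thesis unfolding A_def P_def by blast
  next
    case True
    \<comment> \<open>\<open>C q\<close> is the grade class of the vertices whose longest such path
      has \<open>q + 1\<close> vertices.\<close>
    define C where "C q = A q - A (Suc q)" for q
    have A0: "x \<in> A 0" if "x \<in> X" for x
      using that unfolding A_def P_def by (auto intro!: exI[of _ "[x]"])
    have AX: "A q \<subseteq> X" for q
    proof
      fix x assume "x \<in> A q"
      then obtain xs where "P q x xs" unfolding A_def by blast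
      then have "xs \<noteq> []" "set xs \<subseteq> X" "last xs = x" unfolding P_def by auto
      then show "x \<in> X" using last_in_set by blast
    qed
    have step: "y \<in> A (Suc q)" if x: "x \<in> A q" and y: "y \<in> X" and xy: "\<rho> x < \<rho> y" "R x y" for x y q
    proof -
      obtain xs where xs: "P q x xs" using x unfolding A_def by blast
      have ne: "xs \<noteq> []" "last xs = x" using xs unfolding P_def by auto
      have "\<rho> z < \<rho> y" if z: "z \<in> set xs" for z
      proof -
        have "xs = butlast xs @ [x]" using ne by (metis append_butlast_last_id)
        moreover from this have "sorted_wrt (\<lambda>x y. \<rho> x < \<rho> y) (butlast xs @ [x])"
          using xs unfolding P_def by simp
        ultimately have "z = x \<or> \<rho> z < \<rho> x"
          using z by (metis sorted_wrt_append Un_iff set_append list.set_intros(1) empty_iff empty_set set_ConsD)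
        then show ?thesis using xy(1) by auto
      qed
      then have "P (Suc q) y (xs @ [y])"
        using xs ne xy y unfolding P_def
        by (auto simp: successively_append_iff sorted_wrt_append)
      then show ?thesis unfolding A_def by blast
    qed
    have cov: "X \<subseteq> (\<Union>q<m. C q)"
    proof
      fix x assume x: "x \<in> X"
      have "x \<notin> A m" using True by simp
      moreover have "x \<in> A q" if "\<And>q. q < m \<Longrightarrow> x \<in> A q \<Longrightarrow> x \<in> A (Suc q)" "q \<le> m" for q
        using that(2) by (induction q) (use A0[OF x] that(1) in auto)
      ultimately obtain q where "q < m" "x \<in> A q" "x \<notin> A (Suc q)"
        by blast
      then show "x \<in> (\<Union>q<m. C q)" unfolding C_def by blast
    qed
    have CX: "C q \<subseteq> X" for q using AX[of q] unfolding C_def by blast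
    have finC: "finite (C q)" for q using CX fin finite_subset by blast
    have anti: "\<forall>x\<in>C q. \<forall>y\<in>C q. \<rho> x < \<rho> y \<longrightarrow> \<not> R x y" for q
      using step CX unfolding C_def by blast
    have "card X \<le> card (\<Union>q<m. C q)" using cov finC by (intro card_mono) auto
    also have "\<dots> \<le> (\<Sum>q<m. card (C q))" by (intro card_UN_le) auto
    finally have le: "card X \<le> (\<Sum>q<m. card (C q))" .
    have "\<exists>q. card X \<le> m * card (C q)"
    proof (rule ccontr)
      assume "\<not> ?thesis"
      then have lt: "m * card (C q) < card X" for q by (auto simp: not_le)
      have m: "m > 0" using le lt[of 0] by (cases m) auto
      have "m * (\<Sum>q<m. card (C q)) = (\<Sum>q<m. m * card (C q))" by (simp add: sum_distrib_left)
      also have "\<dots> < (\<Sum>q<m. card X)" using lt m by (intro sum_strict_mono) auto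
      finally have "m * (\<Sum>q<m. card (C q)) < m * card X" by simp
      then show False using le by simp
    qed
    then obtain q where "card X \<le> m * card (C q)" ..
    then have "\<exists>J\<subseteq>X. (\<forall>x\<in>J. \<forall>y\<in>J. \<rho> x < \<rho> y \<longrightarrow> \<not> R x y) \<and> card X \<le> m * card J"
      using anti[of q] CX[of q] by (intro exI[of _ "C q"]) simp
    then show ?thesis ..
  qed
qed

text \<open>Order the layer so that the descendants of every vertex form an interval (the numbering
  \<open>\<rho>\<close> below). On an increasing path \<open>x\<^sub>0, \<dots>, x\<^sub>2\<^sub>r\<^sub>-\<^sub>1\<close> let \<open>j\<close> be the height at which the ends
  have their least common ancestor. By the interval property some consecutive pair already
  separates at height \<open>j\<close>, and so does every window containing it. The ends of a window with
  \<open>2 * (r - j) + 1\<close> steps are joined through the tree by \<open>2 * j\<close> edges, giving a cycle of length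
  \<open>2 * r + 1\<close>.\<close>

lemma tree_layer_independent:
  fixes L :: "nat \<Rightarrow> 'a set" and p :: "'a \<Rightarrow> 'a"
  assumes loopless: "\<And>x. {x} \<notin> E"
    and disj: "\<And>i j x. x \<in> L i \<Longrightarrow> x \<in> L j \<Longrightarrow> i = j"
    and par: "\<And>i x. x \<in> L (Suc i) \<Longrightarrow> p x \<in> L i \<and> {p x, x} \<in> E"
    and root: "L 0 = {v}"
    and fin: "\<And>i. finite (L i)"
    and i: "1 \<le> i" "i \<le> r"
    and free: "\<And>xs. cycle_in E xs \<Longrightarrow> length xs \<noteq> 2 * r + 1"
  shows "\<exists>J\<subseteq>L i. indep E J \<and> card (L i) \<le> (2 * r - 1) * card J"
proof -
  have "finite (\<Union>j\<le>i. L j)" using fin by auto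
  then obtain ix where "bij_betw ix (\<Union>j\<le>i. L j) {0..<card (\<Union>j\<le>i. L j)}"
    using ex_bij_betw_finite_nat by blast
  then obtain M :: nat where inj: "inj_on ix (\<Union>j\<le>i. L j)" and lt: "\<And>j x. j \<le> i \<Longrightarrow> x \<in> L j \<Longrightarrow> ix x < M"
    unfolding bij_betw_def by (metis (no_types, lifting) UN_I atLeastLessThan_iff atMost_iff imageI)
  \<comment> \<open>The indices of the ancestors are read as digits in base \<open>M\<close>, most
    significant at the root, so codes compare root paths lexicographically. \<open>div M\<close>
    recovers the code of the parent and \<open>mod M\<close> the own index.\<close>
  define \<rho> :: "nat \<Rightarrow> 'a \<Rightarrow> nat" where
    "\<rho> = rec_nat (\<lambda>_. 0) (\<lambda>_ f x. f (p x) * M + ix x)"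
  have \<rho>0: "\<rho> 0 x = 0" and \<rho>S: "\<rho> (Suc j) x = \<rho> j (p x) * M + ix x" for j x
    unfolding \<rho>_def by simp_all
  have pw: "(p ^^ q) x \<in> L (j - q)" if "x \<in> L j" "q \<le> j" for q j x
    using that(2)
  proof (induction q)
    case (Suc q)
    then have "(p ^^ q) x \<in> L (Suc (j - Suc q))" by (simp add: Suc_diff_Suc)
    then show ?case using par by auto
  qed (use that in simp)
  have \<rho>mono1: "\<rho> j (p x) \<le> \<rho> j (p y)" if "\<rho> (Suc j) x \<le> \<rho> (Suc j) y" "Suc j \<le> i" "x \<in> L (Suc j)" "y \<in> L (Suc j)" for j x y
  proof -
    have "ix x < M" "ix y < M" using lt that by auto
    then have "\<rho> (Suc j) x div M = \<rho> j (p x)" "\<rho> (Suc j) y div M = \<rho> j (p y)"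
      by (auto simp: \<rho>S)
    then show ?thesis using that(1) by (metis div_le_mono)
  qed
  have \<rho>mono: "\<rho> (i - q) ((p ^^ q) x) \<le> \<rho> (i - q) ((p ^^ q) y)"
    if "\<rho> i x \<le> \<rho> i y" "q \<le> i" "x \<in> L i" "y \<in> L i" for q x y
    using that(2)
  proof (induction q)
    case (Suc q)
    have s: "i - q = Suc (i - Suc q)" using Suc.prems by simp
    show ?case
      using \<rho>mono1[of "i - Suc q" "(p ^^ q) x" "(p ^^ q) y"] Suc pw[OF that(3), of q] pw[OF that(4), of q] s
      by simp
  qed (use that in simp)
  have \<rho>inj: "x = y" if "\<rho> j x = \<rho> j y" "x \<in> L j" "y \<in> L j" "j \<le> i" for j x y
  proof (cases j)
    case 0
    then show ?thesis using that root by auto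
  next
    case (Suc j')
    have "ix x < M" "ix y < M" using lt that by auto
    then have "\<rho> j x mod M = ix x" "\<rho> j y mod M = ix y" unfolding Suc by (auto simp: \<rho>S)
    then have "ix x = ix y" using that(1) by simp
    then show ?thesis using inj that unfolding inj_on_def by blast
  qed
  let ?R = "\<lambda>x y. {x, y} \<in> E"
  have no_path: False
    if len: "length xs = 2 * r" and xs: "set xs \<subseteq> L i" and suc: "successively ?R xs"
      and srt: "sorted_wrt (\<lambda>x y. \<rho> i x < \<rho> i y) xs" for xs
  proof -
    have r: "r \<ge> 1" using i by simp
    have xL: "xs ! a \<in> L i" if "a < 2 * r" for a using that len xs by auto
    have dist: "distinct xs"
      using srt by (simp add: sorted_wrt_iff_nth_less distinct_conv_nth) (metis less_irrefl nat_neq_iff)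
    have le: "\<rho> i (xs ! a) \<le> \<rho> i (xs ! b)" if "a \<le> b" "b < 2 * r" for a b
      using that srt len by (cases "a = b") (auto simp: sorted_wrt_iff_nth_less less_imp_le)
    \<comment> \<open>The interval property: passing to ancestors is weakly monotone in the code, so
      a vertex between two with the same \<open>q\<close>-th ancestor is squeezed onto that
      ancestor.\<close>
    have conv: "(p ^^ q) (xs ! b) = (p ^^ q) (xs ! a)"
      if "(p ^^ q) (xs ! a) = (p ^^ q) (xs ! c)" "a \<le> b" "b \<le> c" "c < 2 * r" "q \<le> i" for a b c q
    proof -
      have "\<rho> (i - q) ((p ^^ q) (xs ! a)) \<le> \<rho> (i - q) ((p ^^ q) (xs ! b))"
        "\<rho> (i - q) ((p ^^ q) (xs ! b)) \<le> \<rho> (i - q) ((p ^^ q) (xs ! c))"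
        using that(2-5) by (simp_all add: \<rho>mono le xL)
      then have "\<rho> (i - q) ((p ^^ q) (xs ! b)) = \<rho> (i - q) ((p ^^ q) (xs ! a))" using that(1) by simp
      then show ?thesis using that by (intro \<rho>inj[of "i - q"] pw xL) auto
    qed
    define e where "e q \<longleftrightarrow> (p ^^ q) (xs ! 0) = (p ^^ q) (xs ! (2 * r - 1))" for q
    have "e i"
      using pw[OF xL[of 0], of i] pw[OF xL[of "2 * r - 1"], of i] r root unfolding e_def by auto
    define j where "j = (LEAST q. e q)"
    have j: "e j" "j \<le> i" "\<And>q. q < j \<Longrightarrow> \<not> e q"
      unfolding j_def using \<open>e i\<close> by (auto intro: LeastI Least_le dest: not_less_Least)
    have "\<not> e 0" unfolding e_def using dist len r by (auto simp: nth_eq_iff_index_eq)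
    then have j1: "j \<ge> 1" using j(1) by (cases j) auto
    define q where "q = j - 1"
    have q: "j = Suc q" "q < i" using j1 j(2) unfolding q_def by auto
    have "\<exists>c. Suc c < 2 * r \<and> (p ^^ q) (xs ! c) \<noteq> (p ^^ q) (xs ! Suc c)"
    proof (rule ccontr)
      assume "\<not> ?thesis"
      then have eq: "(p ^^ q) (xs ! c) = (p ^^ q) (xs ! Suc c)" if "Suc c < 2 * r" for c
        using that by blast
      have "(p ^^ q) (xs ! 0) = (p ^^ q) (xs ! c)" if "c < 2 * r" for c
        using that by (induction c) (use eq in auto)
      then have "e q" unfolding e_def using r by simp
      then show False using j(3) q by simp
    qed
    then obtain c where c: "Suc c < 2 * r" "(p ^^ q) (xs ! c) \<noteq> (p ^^ q) (xs ! Suc c)" by blast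
    \<comment> \<open>The window from \<open>a\<close> to \<open>b\<close> has
      \<open>2 * (r - j) + 2\<close> vertices. Starting at \<open>c\<close> it contains the
      separating pair, but it must start no later than \<open>2 * j - 2\<close> to fit into the
      \<open>2 * r\<close> vertices of the path.\<close>
    define a where "a = min c (2 * j - 2)"
    define b where "b = a + (2 * (r - j) + 1)"
    have ab: "a \<le> c" "Suc c \<le> b" "b < 2 * r" "a < b" "a < 2 * r"
      unfolding b_def a_def using c(1) j1 j(2) i by auto
    \<comment> \<open>A common ancestor at height \<open>q'\<close> would persist up to height
      \<open>q\<close>, and the interval property would then merge the ancestors of the separating
      pair.\<close>
    have ne: "(p ^^ q') (xs ! a) \<noteq> (p ^^ q') (xs ! b)" if "q' \<le> q" for q'
    proof
      assume "(p ^^ q') (xs ! a) = (p ^^ q') (xs ! b)"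
      then have "(p ^^ (q - q')) ((p ^^ q') (xs ! a)) = (p ^^ (q - q')) ((p ^^ q') (xs ! b))" by simp
      then have "(p ^^ q) (xs ! a) = (p ^^ q) (xs ! b)"
        using that by (metis comp_apply funpow_add le_add_diff_inverse2)
      then have "(p ^^ q) (xs ! c) = (p ^^ q) (xs ! a)" "(p ^^ q) (xs ! Suc c) = (p ^^ q) (xs ! a)"
        using conv[of q a b c] conv[of q a b "Suc c"] ab q by auto
      then show False using c(2) by simp
    qed
    have top: "(p ^^ j) (xs ! a) = (p ^^ j) (xs ! b)"
      using conv[of j 0 "2 * r - 1" a] conv[of j 0 "2 * r - 1" b] j(1,2) ab unfolding e_def by auto
    \<comment> \<open>\<open>X\<close> is the window, \<open>Y\<close> climbs from the parent of its
      end \<open>b\<close> to the common ancestor at height \<open>j\<close>, and \<open>Z\<close>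
      descends from height \<open>q = j - 1\<close> to the parent of the end \<open>a\<close>. For
      \<open>j = 1\<close> the list \<open>Z\<close> is empty, which is why the closing edge below
      needs two cases.\<close>
    define X where "X = map (\<lambda>s. xs ! (a + s)) [0..<2 * (r - j) + 2]"
    define Y where "Y = map (\<lambda>s. (p ^^ (s + 1)) (xs ! b)) [0..<j]"
    define Z where "Z = map (\<lambda>s. (p ^^ (q - s)) (xs ! a)) [0..<q]"
    have lenXYZ: "length (X @ Y @ Z) = 2 * r + 1"
      unfolding X_def Y_def Z_def using q j(2) i by simp
    have up: "{(p ^^ s) (xs ! d), p ((p ^^ s) (xs ! d))} \<in> E" if "s < i" "d < 2 * r" for s d
    proof -
      have "(p ^^ s) (xs ! d) \<in> L (Suc (i - Suc s))"
        using pw[OF xL[OF that(2)], of s] that(1) by (simp add: Suc_diff_Suc)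
      then show ?thesis using par by (metis insert_commute)
    qed
    have sX: "successively ?R X"
      unfolding X_def using suc len ab by (auto simp: successively_conv_nth b_def simp del: upt_Suc)
    have sY: "successively ?R Y"
      unfolding successively_conv_nth
    proof (intro allI impI)
      fix s assume s: "Suc s < length Y"
      then show "{Y ! s, Y ! Suc s} \<in> E"
        using up[of "Suc s" b] ab j(2) unfolding Y_def by simp
    qed
    have sZ: "successively ?R Z"
      unfolding successively_conv_nth
    proof (intro allI impI)
      fix s assume s: "Suc s < length Z"
      then have "q - s = Suc (q - Suc s)" unfolding Z_def by simp
      then show "{Z ! s, Z ! Suc s} \<in> E"
        using s up[of "q - Suc s" a] ab q(2) unfolding Z_def by (simp add: insert_commute)
    qed
    have "X \<noteq> []" "Y \<noteq> []" unfolding X_def Y_def using j1 by auto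
    have hX: "hd X = xs ! a" "last X = xs ! b"
      unfolding X_def b_def by (auto simp: hd_map last_map hd_upt simp del: upt_Suc)
    have hY: "hd Y = p (xs ! b)" "last Y = (p ^^ j) (xs ! a)"
      unfolding Y_def using top q(1) by (simp_all add: hd_map last_map hd_upt del: upt_Suc)
    have lZ: "Z = [] \<longleftrightarrow> q = 0" unfolding Z_def by simp
    have hZ: "hd Z = (p ^^ q) (xs ! a)" "last Z = p (xs ! a)" if "q > 0"
      unfolding Z_def using that by (auto simp: hd_map last_map hd_upt)
    have "{xs ! b, p (xs ! b)} \<in> E" using up[of 0 b] ab q by simp
    then have e1: "{last X, hd Y} \<in> E" using hX hY by simp
    have e2: "{last Y, hd Z} \<in> E" if "q > 0"
      using up[of q a] hY hZ[OF that] ab q by (simp add: insert_commute)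
    have e3: "{last (Y @ Z), hd X} \<in> E"
    proof (cases "q = 0")
      case True
      then show ?thesis using up[of 0 a] lZ hY hX q ab by (simp add: insert_commute)
    next
      case False
      then show ?thesis using up[of 0 a] lZ hZ hX q ab by (simp add: insert_commute)
    qed
    have "successively ?R (X @ Y @ Z)"
      using sX sY sZ e1 e2 lZ \<open>X \<noteq> []\<close> \<open>Y \<noteq> []\<close> by (auto simp: successively_append_iff)
    moreover have "{last (X @ Y @ Z), hd (X @ Y @ Z)} \<in> E"
      using e3 \<open>X \<noteq> []\<close> \<open>Y \<noteq> []\<close> by simp
    ultimately have "cycle_edges (X @ Y @ Z) \<subseteq> E"
      using cycle_edges_conv \<open>X \<noteq> []\<close> by (metis append_is_Nil_conv)
    moreover have "distinct (X @ Y @ Z)"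
    proof -
      \<comment> \<open>Different heights mean different layers, hence different vertices. Only
        \<open>Y\<close> and \<open>Z\<close> meet in equal heights; there \<open>ne\<close> keeps
        the two branches apart.\<close>
      have lay: "s = s'" if "(p ^^ s) (xs ! d) = (p ^^ s') (xs ! d')" "s \<le> i" "s' \<le> i" "d < 2 * r" "d' < 2 * r" for s s' d d'
      proof -
        have "i - s = i - s'"
          using disj pw[OF xL[OF that(4)], of s] pw[OF xL[OF that(5)], of s'] that by metis
        then show ?thesis using that by simp
      qed
      have qle: "q - s \<le> i" for s using q(2) by simp
      have "distinct X"
        unfolding X_def distinct_map inj_on_def using dist len ab
        by (auto simp: nth_eq_iff_index_eq b_def)
      moreover have "distinct Y"
      proof -
        have "s = s'" if "s < j" "s' < j" "(p ^^ (s + 1)) (xs ! b) = (p ^^ (s' + 1)) (xs ! b)" for s s'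
          using lay[OF that(3)] that(1,2) j(2) ab by simp
        then show ?thesis unfolding Y_def distinct_map inj_on_def by auto
      qed
      moreover have "distinct Z"
      proof -
        have "s = s'" if "s < q" "s' < q" "(p ^^ (q - s)) (xs ! a) = (p ^^ (q - s')) (xs ! a)" for s s'
        proof -
          have "q - s = q - s'" using lay[OF that(3)] qle ab by simp
          then show ?thesis using that(1,2) by simp
        qed
        then show ?thesis unfolding Z_def distinct_map inj_on_def by auto
      qed
      moreover have "set X \<inter> set Y = {}"
      proof -
        have False if "s < 2 * (r - j) + 2" "s' < j" "xs ! (a + s) = (p ^^ (s' + 1)) (xs ! b)" for s s'
          using lay[of 0 "a + s" "s' + 1" b] that ab j(2) unfolding b_def by auto
        then show ?thesis unfolding X_def Y_def by force
      qed
      moreover have "set X \<inter> set Z = {}"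
      proof -
        have False if "s < 2 * (r - j) + 2" "s' < q" "xs ! (a + s) = (p ^^ (q - s')) (xs ! a)" for s s'
          using lay[of 0 "a + s" "q - s'" a] qle[of s'] that ab q(2) unfolding b_def by auto
        then show ?thesis unfolding X_def Z_def by force
      qed
      moreover have "set Y \<inter> set Z = {}"
      proof -
        have False if "s < j" "s' < q" "(p ^^ (s + 1)) (xs ! b) = (p ^^ (q - s')) (xs ! a)" for s s'
        proof -
          have "s + 1 = q - s'" using lay[OF that(3)] qle[of s'] that(1) ab j(2) by simp
          then show False using that(3) ne[of "q - s'"] by simp
        qed
        then show ?thesis unfolding Y_def Z_def by force
      qed
      ultimately show ?thesis by auto
    qed
    ultimately have "cycle_in E (X @ Y @ Z)" unfolding cycle_in_def by blast
    then show False using free lenXYZ by blast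
  qed
  have "Suc (2 * r - 1) = 2 * r" using i by simp
  then obtain J where J: "J \<subseteq> L i" "\<forall>x\<in>J. \<forall>y\<in>J. \<rho> i x < \<rho> i y \<longrightarrow> {x, y} \<notin> E"
    "card (L i) \<le> (2 * r - 1) * card J"
    using increasing_path_or_antichain[OF fin[of i], of "2 * r - 1" ?R "\<rho> i"] no_path by metis
  have "indep E J"
    unfolding indep_def
  proof (intro ballI)
    fix x y assume xy: "x \<in> J" "y \<in> J"
    consider "x = y" | "\<rho> i x < \<rho> i y" | "\<rho> i y < \<rho> i x"
      using \<rho>inj[of i x y] xy J(1) by (metis subsetD linorder_less_linear order_refl)
    then show "{x, y} \<notin> E"
      using xy J(2) loopless by cases (auto simp: insert_commute)
  qed
  then show ?thesis using J by blast
qed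

section \<open>Breadth-first layers\<close>

definition nbhd :: "'a set set \<Rightarrow> 'a set \<Rightarrow> 'a \<Rightarrow> 'a set" where
  "nbhd E U v = {y \<in> U. {v, y} \<in> E}"

text \<open>In a graph on \<open>V\<close>, these are exactly the edges whose deletion makes
  \<open>c\<close> a proper colouring, so their number bounds \<open>h_graph\<close>.\<close>

definition mono_edges :: "'a set set \<Rightarrow> 'a set \<Rightarrow> ('a \<Rightarrow> 'b) \<Rightarrow> 'a set set" where
  "mono_edges E V c = {e \<in> E. e \<subseteq> V \<and> (\<forall>x\<in>e. \<forall>y\<in>e. c x = c y)}"

primrec bfs_ball :: "'a set set \<Rightarrow> 'a set \<Rightarrow> 'a \<Rightarrow> nat \<Rightarrow> 'a set" where
  "bfs_ball E U v 0 = {v}"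
| "bfs_ball E U v (Suc i) = bfs_ball E U v i \<union> (\<Union>x\<in>bfs_ball E U v i. nbhd E U x)"

definition bfs_layer :: "'a set set \<Rightarrow> 'a set \<Rightarrow> 'a \<Rightarrow> nat \<Rightarrow> 'a set" where
  "bfs_layer E U v i = (case i of 0 \<Rightarrow> {v} | Suc j \<Rightarrow> bfs_ball E U v i - bfs_ball E U v j)"

lemma bfs_layer_0 [simp]: "bfs_layer E U v 0 = {v}"
  by (simp add: bfs_layer_def)

lemma bfs_layer_Suc: "bfs_layer E U v (Suc i) = bfs_ball E U v (Suc i) - bfs_ball E U v i"
  by (simp add: bfs_layer_def)

lemma bfs_ball_mono: "i \<le> j \<Longrightarrow> bfs_ball E U v i \<subseteq> bfs_ball E U v j"
  by (rule lift_Suc_mono_le) auto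

lemma bfs_ball_subset: "v \<in> U \<Longrightarrow> bfs_ball E U v i \<subseteq> U"
  by (induction i) (auto simp: nbhd_def)

lemma bfs_layer_subset_ball: "bfs_layer E U v i \<subseteq> bfs_ball E U v i"
  by (cases i) (auto simp: bfs_layer_Suc)

lemma bfs_layer_disjoint:
  assumes "x \<in> bfs_layer E U v i" "x \<in> bfs_layer E U v j"
  shows "i = j"
proof -
  have False if ij: "i < j" and "x \<in> bfs_layer E U v i" "x \<in> bfs_layer E U v j" for i j
  proof -
    obtain j' where j': "j = Suc j'" "i \<le> j'" using less_imp_Suc_add[OF ij] by (metis le_add1)
    have "x \<in> bfs_ball E U v j'"
      by (rule subsetD[OF bfs_ball_mono[OF j'(2)] subsetD[OF bfs_layer_subset_ball that(2)]])
    then show False using that(3) j' by (simp add: bfs_layer_Suc)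
  qed
  then show ?thesis using assms by (meson linorder_neqE_nat)
qed

lemma bfs_layer_parent:
  assumes "x \<in> bfs_layer E U v (Suc i)"
  shows "\<exists>y \<in> bfs_layer E U v i. {y, x} \<in> E"
proof -
  from assms obtain y where y: "y \<in> bfs_ball E U v i" "x \<in> nbhd E U y" "x \<notin> bfs_ball E U v i"
    by (auto simp: bfs_layer_Suc)
  have "y \<in> bfs_layer E U v i"
    using y by (cases i) (auto simp: bfs_layer_Suc)
  then show ?thesis using y(2) by (auto simp: nbhd_def)
qed

text \<open>If the layers \<open>1, \<dots>, r\<close> all expand by the factor \<open>t\<close>, then layer \<open>r\<close> contains a forbidden large
  independent set; otherwise the first layer that does not expand has a large independent subset
  compared with the ball around it, which contains all its neighbours.\<close>

lemma expansion_step: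
  fixes t D :: real
  assumes edges: "\<And>e. e \<in> E \<Longrightarrow> card e = 2"
    and free: "\<And>xs. cycle_in E xs \<Longrightarrow> length xs \<noteq> 2 * r + 1"
    and r: "r \<ge> 1" and fin: "finite U" and v: "v \<in> U" and t: "t \<ge> 1"
    and D: "D \<ge> 0" "D < card (nbhd E U v)"
    and small: "\<And>J. J \<subseteq> U \<Longrightarrow> indep E J \<Longrightarrow> real ((2 * r - 1) * card J) \<le> t ^ (r - 1) * D"
  shows "\<exists>B J. J \<subseteq> B \<and> B \<subseteq> U \<and> B \<noteq> {} \<and> indep E J \<and> (\<forall>x\<in>J. \<forall>y\<in>U. {x, y} \<in> E \<longrightarrow> y \<in> B) \<and>
           card B \<le> (t + r) * (2 * real r - 1) * card J"
proof -
  let ?L = "bfs_layer E U v" and ?B = "bfs_ball E U v"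
  have loopless: "{x} \<notin> E" for x using edges[of "{x}"] by auto
  have finB: "finite (?B i)" for i using bfs_ball_subset[OF v] fin finite_subset by metis
  have finL: "finite (?L i)" for i using bfs_layer_subset_ball finB finite_subset by metis
  \<comment> \<open>One parent function for all layers: the layer index is quantified inside the
    choice, and disjointness of the layers then determines it.\<close>
  define p where "p x = (SOME y. \<exists>i. x \<in> ?L (Suc i) \<and> y \<in> ?L i \<and> {y, x} \<in> E)" for x
  have p: "p x \<in> ?L i \<and> {p x, x} \<in> E" if x: "x \<in> ?L (Suc i)" for x i
  proof -
    have "\<exists>y i. x \<in> ?L (Suc i) \<and> y \<in> ?L i \<and> {y, x} \<in> E" using bfs_layer_parent[OF x] x by blast
    then have "\<exists>i. x \<in> ?L (Suc i) \<and> p x \<in> ?L i \<and> {p x, x} \<in> E" unfolding p_def by (rule someI_ex)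
    then show ?thesis using bfs_layer_disjoint[OF x] by (metis nat.inject)
  qed
  have indL: "\<exists>J\<subseteq>?L i. indep E J \<and> card (?L i) \<le> (2 * r - 1) * card J" if "1 \<le> i" "i \<le> r" for i
    by (rule tree_layer_independent[where p = p and v = v and r = r])
      (use loopless p finL free that bfs_layer_disjoint in auto)
  have LU: "?L i \<subseteq> U" for i using bfs_layer_subset_ball bfs_ball_subset[OF v] by (metis order_trans)
  have L1: "?L 1 = nbhd E U v" using loopless by (auto simp: bfs_layer_Suc nbhd_def)
  \<comment> \<open>Otherwise layer \<open>r\<close> has at least \<open>t ^ (r - 1)\<close> times
    as many vertices as \<open>v\<close> has neighbours, hence more than
    \<open>t ^ (r - 1) * D\<close>, and its large independent subset violates
    \<open>small\<close>.\<close>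
  have "\<exists>i. 1 \<le> i \<and> i < r \<and> card (?L (Suc i)) \<le> t * card (?L i)"
  proof (rule ccontr)
    assume "\<not> ?thesis"
    then have ex: "t * card (?L i) \<le> card (?L (Suc i))" if "1 \<le> i" "i < r" for i
      using that by (meson less_imp_le not_le)
    have "t ^ m * card (?L 1) \<le> card (?L (Suc m))" if "m < r" for m
      using that
    proof (induction m)
      case (Suc m)
      have "t ^ Suc m * card (?L 1) = t * (t ^ m * card (?L 1))" by simp
      also have "\<dots> \<le> t * card (?L (Suc m))"
        using Suc t by (intro mult_left_mono) auto
      also have "\<dots> \<le> card (?L (Suc (Suc m)))" using ex Suc.prems by auto
      finally show ?case .
    qed simp
    from this[of "r - 1"] have big: "t ^ (r - 1) * card (?L 1) \<le> card (?L r)" using r by simp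
    obtain J where J: "J \<subseteq> ?L r" "indep E J" "card (?L r) \<le> (2 * r - 1) * card J"
      using indL[of r] r by blast
    have "t ^ (r - 1) * D < t ^ (r - 1) * card (?L 1)"
      using D t unfolding L1 by (intro mult_strict_left_mono) auto
    also have "\<dots> \<le> real ((2 * r - 1) * card J)" using big J(3) by (meson of_nat_mono order_trans)
    also have "\<dots> \<le> t ^ (r - 1) * D" using small J LU by (meson order_trans)
    finally show False by simp
  qed
  then obtain i0 where "1 \<le> i0 \<and> i0 < r \<and> card (?L (Suc i0)) \<le> t * card (?L i0)" ..
  define Q where "Q i \<longleftrightarrow> 1 \<le> i \<and> i < r \<and> card (?L (Suc i)) \<le> t * card (?L i)" for i
  \<comment> \<open>Before the first layer that fails to expand, sizes do not decrease. So the
    \<open>i + 1 \<le> r\<close> layers of the ball of radius \<open>i\<close> have at most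
    \<open>r\<close> times the size of layer \<open>i\<close>, and layer \<open>i + 1\<close> adds
    at most \<open>t\<close> times that size.\<close>
  define i where "i = (LEAST i. Q i)"
  have "Q i0" unfolding Q_def by fact
  then have i: "Q i" "\<And>j. j < i \<Longrightarrow> \<not> Q j"
    unfolding i_def by (auto intro: LeastI dest: not_less_Least)
  have ir: "1 \<le> i" "i < r" using i(1) unfolding Q_def by auto
  have inc: "card (?L j) \<le> card (?L (Suc j))" if "j < i" for j
  proof (cases "j = 0")
    case True
    have "card (?L 1) > 0" using D unfolding L1 by linarith
    then show ?thesis using True by simp
  next
    case False
    then have "t * card (?L j) \<le> card (?L (Suc j))"
      using i(2)[OF that] that ir unfolding Q_def by auto
    moreover have "1 * real (card (?L j)) \<le> t * card (?L j)" using t by (intro mult_right_mono) auto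
    ultimately show ?thesis by (metis mult_1 of_nat_le_iff order_trans)
  qed
  have le: "card (?L j) \<le> card (?L i)" if "j \<le> i" for j
    using that by (induction rule: inc_induct) (use inc in \<open>auto intro: order_trans\<close>)
  have Bstep: "card (?B (Suc j)) \<le> card (?B j) + card (?L (Suc j))" for j
  proof -
    have "?B (Suc j) = ?B j \<union> ?L (Suc j)" by (auto simp: bfs_layer_Suc)
    then show ?thesis by (metis card_Un_le)
  qed
  have "card (?B j) \<le> Suc j * card (?L i)" if "j \<le> i" for j
    using that
  proof (induction j)
    case 0
    then show ?case using le[of 0] by simp
  next
    case (Suc j)
    then show ?case using Bstep[of j] le[of "Suc j"] by (simp del: bfs_ball.simps)
  qed
  from this[of i] have "card (?B i) \<le> r * card (?L i)"
    using ir by (metis Suc_leI le_refl mult_le_mono1 order_trans)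
  then have "real (card (?B (Suc i))) \<le> real (r * card (?L i)) + card (?L (Suc i))"
    using Bstep[of i] by (metis add_le_mono1 of_nat_add of_nat_mono order_trans)
  also have "\<dots> \<le> real r * card (?L i) + t * card (?L i)" using i(1) unfolding Q_def by simp
  also have "\<dots> = (t + r) * card (?L i)" by (simp add: algebra_simps)
  finally have cB: "card (?B (Suc i)) \<le> (t + r) * card (?L i)" .
  obtain J where J: "J \<subseteq> ?L i" "indep E J" "card (?L i) \<le> (2 * r - 1) * card J"
    using indL[of i] ir by auto
  have "(t + r) * card (?L i) \<le> (t + r) * real ((2 * r - 1) * card J)"
    using t by (intro mult_left_mono of_nat_mono J(3)) auto
  then have card_B: "card (?B (Suc i)) \<le> (t + r) * (2 * real r - 1) * card J"
    using cB r by (simp add: of_nat_diff mult.assoc)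
  have "J \<subseteq> ?B i" using J(1) bfs_layer_subset_ball by (rule order_trans)
  then have JB: "J \<subseteq> ?B (Suc i)" "\<forall>x\<in>J. \<forall>y\<in>U. {x, y} \<in> E \<longrightarrow> y \<in> ?B (Suc i)"
    by (auto simp: nbhd_def)
  have "?B (Suc i) \<noteq> {}" using bfs_ball_mono[of 0 "Suc i" E U v] by auto
  show ?thesis
    by (rule exI[of _ "?B (Suc i)"], rule exI[of _ J])
      (use J(2) bfs_ball_subset[OF v, of E "Suc i"] card_B JB \<open>?B (Suc i) \<noteq> {}\<close> in \<open>simp del: bfs_ball.simps\<close>)
qed

section \<open>Colourings with few monochromatic edges\<close>

lemma finite_mono_edges: "finite V \<Longrightarrow> finite (mono_edges E V c)"
  by (rule finite_subset[of _ "Pow V"]) (auto simp: mono_edges_def)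

lemma card_mono_edges_le:
  assumes "finite V" and "\<And>e. e \<in> E \<Longrightarrow> card e = 2"
  shows "card (mono_edges E V c) \<le> card V ^ 2"
proof -
  have "mono_edges E V c \<subseteq> (\<lambda>(x, y). {x, y}) ` (V \<times> V)"
  proof
    fix e assume "e \<in> mono_edges E V c"
    then have "card e = 2" "e \<subseteq> V" using assms(2) by (auto simp: mono_edges_def)
    then show "e \<in> (\<lambda>(x, y). {x, y}) ` (V \<times> V)" by (force simp: card_2_iff)
  qed
  then have "card (mono_edges E V c) \<le> card ((\<lambda>(x, y). {x, y}) ` (V \<times> V))"
    using assms(1) by (intro card_mono) auto
  also have "\<dots> \<le> card (V \<times> V)" using assms(1) by (intro card_image_le) auto
  finally show ?thesis by (simp add: card_cartesian_product power2_eq_square)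
qed

lemma exists_small_class:
  fixes c :: "'a \<Rightarrow> nat"
  assumes "finite N" "k \<ge> 1"
  shows "\<exists>a<k. k * card {y \<in> N. c y = a} \<le> card N"
proof (rule ccontr)
  assume "\<not> ?thesis"
  then have gt: "card N < k * card {y \<in> N. c y = a}" if "a < k" for a using that by (meson not_le)
  have "k * card N = (\<Sum>a<k. card N)" by simp
  also have "\<dots> < (\<Sum>a<k. k * card {y \<in> N. c y = a})"
    using gt assms(2) by (intro sum_strict_mono) (auto simp: lessThan_empty_iff)
  also have "\<dots> = k * (\<Sum>a<k. card {y \<in> N. c y = a})" by (simp add: sum_distrib_left)
  also have "(\<Sum>a<k. card {y \<in> N. c y = a}) = card (\<Union>a<k. {y \<in> N. c y = a})"
    using assms(1) by (subst card_UN_disjoint) auto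
  also have "\<dots> \<le> card N" using assms(1) by (intro card_mono) auto
  finally show False by simp
qed

text \<open>Repeatedly remove a vertex of degree at most \<open>D\<close> in the remaining graph or,
  failing that, a ball from \<open>expansion_step\<close>. The single vertices form \<open>S\<close>
  and are coloured greedily in reverse order. The balls cover \<open>U - S\<close>, and the union of
  their independent sets is \<open>I\<close>.\<close>

lemma peel:
  fixes t D :: real
  assumes edges: "\<And>e. e \<in> E \<Longrightarrow> card e = 2"
    and free: "\<And>xs. cycle_in E xs \<Longrightarrow> length xs \<noteq> 2 * r + 1"
    and r: "r \<ge> 1" and fin: "finite U" and t: "t \<ge> 1" and D: "D \<ge> 0" and k: "k \<ge> 1"
    and small: "\<And>J. J \<subseteq> U \<Longrightarrow> indep E J \<Longrightarrow> real ((2 * r - 1) * card J) \<le> t ^ (r - 1) * D"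
  shows "\<exists>S I c. S \<subseteq> U \<and> I \<subseteq> U \<and> indep E I \<and> (\<forall>x. c x < (k::nat)) \<and>
           card (mono_edges E S c) \<le> card S * (D / k) \<and> card (U - S) \<le> (t + r) * (2 * real r - 1) * card I"
  using fin small
proof (induction "card U" arbitrary: U rule: less_induct)
  case less
  note fin = less.prems(1) and small = less.prems(2)
  consider "U = {}" | v where "v \<in> U" "card (nbhd E U v) \<le> D"
    | v where "v \<in> U" "D < card (nbhd E U v)" by fastforce
  then show ?case
  proof cases
    case 1
    have "mono_edges E {} (\<lambda>_. 0 :: nat) = {}" using edges by (force simp: mono_edges_def)
    show ?thesis
      by (rule exI[of _ "{}"], rule exI[of _ "{}"], rule exI[of _ "\<lambda>_. 0"])
        (use \<open>mono_edges E {} _ = {}\<close> 1 k in \<open>simp add: indep_def\<close>)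
  next
    case 2
    let ?U = "U - {v}"
    have "card ?U < card U" using fin 2(1) by (rule card_Diff1_less)
    from less.hyps[OF this finite_Diff[OF fin] small]
    obtain S I c where IH: "S \<subseteq> ?U" "I \<subseteq> ?U" "indep E I" "\<forall>x. c x < k"
      "card (mono_edges E S c) \<le> card S * (D / k)" "card (?U - S) \<le> (t + r) * (2 * real r - 1) * card I"
      by blast
    have finS: "finite S" using IH(1) fin by (meson finite_Diff finite_subset)
    then have finN: "finite (nbhd E S v)" by (simp add: nbhd_def)
    \<comment> \<open>The neighbours of \<open>v\<close> that are already coloured lie in
      \<open>S \<subseteq> U\<close>, so there are at most \<open>D\<close> of them; a colour of at
      most average frequency creates at most \<open>D / k\<close> new monochromatic edges.\<close>
    obtain a where a: "a < k" "k * card {y \<in> nbhd E S v. c y = a} \<le> card (nbhd E S v)"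
      using exists_small_class[OF finN k] by blast
    let ?c = "c(v := a)" and ?N = "{y \<in> nbhd E S v. c y = a}"
    have sub: "mono_edges E (insert v S) ?c \<subseteq> mono_edges E S c \<union> (\<lambda>y. {v, y}) ` ?N"
    proof
      fix e assume e: "e \<in> mono_edges E (insert v S) ?c"
      then have eE: "e \<in> E" "e \<subseteq> insert v S" "\<forall>x\<in>e. \<forall>y\<in>e. ?c x = ?c y"
        unfolding mono_edges_def by blast+
      show "e \<in> mono_edges E S c \<union> (\<lambda>y. {v, y}) ` ?N"
      proof (cases "v \<in> e")
        case True
        then obtain y where y: "e = {v, y}" "y \<noteq> v" using edges[OF eE(1)] by (auto simp: card_2_iff)
        then have "y \<in> S" "c y = a" using eE(2) eE(3)[rule_format, of v y] by auto
        then show ?thesis using y(1) eE(1) by (auto simp: nbhd_def)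
      next
        case False
        then have "e \<subseteq> S" using eE(2) by blast
        moreover have "c x = c y" if "x \<in> e" "y \<in> e" for x y
          using eE(3)[rule_format, OF that] that False by (metis fun_upd_other)
        ultimately show ?thesis using eE(1) unfolding mono_edges_def by blast
      qed
    qed
    have "card (mono_edges E (insert v S) ?c) \<le> card (mono_edges E S c \<union> (\<lambda>y. {v, y}) ` ?N)"
      using sub finN finite_mono_edges[OF finS] by (intro card_mono) auto
    also have "\<dots> \<le> card (mono_edges E S c) + card ((\<lambda>y. {v, y}) ` ?N)" by (rule card_Un_le)
    also have "\<dots> \<le> card (mono_edges E S c) + card ?N" using finN by (intro add_left_mono card_image_le) auto
    finally have m: "real (card (mono_edges E (insert v S) ?c)) \<le> card (mono_edges E S c) + card ?N"
      by (metis of_nat_add of_nat_mono)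
    have "card (nbhd E S v) \<le> card (nbhd E U v)"
      using IH(1) fin by (intro card_mono) (auto simp: nbhd_def)
    then have "real k * card ?N \<le> D" using a(2) 2(2) by (metis of_nat_mono of_nat_mult order_trans)
    then have "card ?N \<le> D / k" using k by (simp add: field_simps)
    moreover have "card (insert v S) = Suc (card S)" using IH(1) finS by (subst card_insert_disjoint) auto
    ultimately have mono: "card (mono_edges E (insert v S) ?c) \<le> card (insert v S) * (D / k)"
      using m IH(5) by (simp add: algebra_simps add_divide_distrib)
    have "U - insert v S = ?U - S" by auto
    show ?thesis
      by (rule exI[of _ "insert v S"], rule exI[of _ I], rule exI[of _ ?c])
        (use IH(1-4,6) 2(1) a(1) mono \<open>U - insert v S = ?U - S\<close> in auto)
  next
    case 3
    obtain B J where BJ: "J \<subseteq> B" "B \<subseteq> U" "B \<noteq> {}" "indep E J" "\<forall>x\<in>J. \<forall>y\<in>U. {x, y} \<in> E \<longrightarrow> y \<in> B"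
      "card B \<le> (t + r) * (2 * real r - 1) * card J"
      using expansion_step[OF edges free r fin 3(1) t D 3(2) small] by blast
    have finB: "finite B" using BJ(2) fin finite_subset by blast
    have "card (U - B) < card U" using BJ(2,3) fin by (intro psubset_card_mono) auto
    from less.hyps[OF this finite_Diff[OF fin] small]
    obtain S I c where IH: "S \<subseteq> U - B" "I \<subseteq> U - B" "indep E I" "\<forall>x. c x < k"
      "card (mono_edges E S c) \<le> card S * (D / k)" "card (U - B - S) \<le> (t + r) * (2 * real r - 1) * card I"
      by blast
    \<comment> \<open>\<open>I\<close> avoids \<open>B\<close>, whereas every neighbour of
      \<open>J\<close> in \<open>U\<close> lies in \<open>B\<close>, so no edge joins the two
      sets.\<close>
    have ind: "indep E (I \<union> J)"
      using IH(2,3) BJ(4,5) unfolding indep_def by (auto simp: insert_commute)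
    have "card (U - S) \<le> card (U - B - S) + card B"
    proof -
      have "U - S \<subseteq> (U - B - S) \<union> B" by auto
      then have "card (U - S) \<le> card ((U - B - S) \<union> B)" using fin finB by (intro card_mono) auto
      then show ?thesis using card_Un_le[of "U - B - S" B] by linarith
    qed
    moreover have "card (I \<union> J) = card I + card J"
      using IH(2) BJ(1) fin finB by (intro card_Un_disjoint) (auto intro: finite_subset)
    ultimately have left: "real (card (U - S)) \<le> (t + r) * (2 * real r - 1) * card (I \<union> J)"
      using IH(6) BJ(6) by (simp add: distrib_left)
    show ?thesis
      by (rule exI[of _ S], rule exI[of _ "I \<union> J"], rule exI[of _ c])
        (use IH BJ ind left in auto)
  qed
qed

text \<open>Shifting \<open>c2\<close> by \<open>k1\<close> makes the palettes disjoint, so no edge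
  between \<open>W\<close> and its complement is monochromatic.\<close>

lemma combine_colourings:
  assumes "W \<subseteq> V" "finite V" "\<And>x. x \<in> W \<Longrightarrow> c1 x < k1" "\<And>x. x \<in> V - W \<Longrightarrow> c2 x < k2"
  shows "\<exists>c :: 'a \<Rightarrow> nat. (\<forall>x\<in>V. c x < k1 + k2) \<and>
           card (mono_edges E V c) \<le> card (mono_edges E W c1) + card (mono_edges E (V - W) c2)"
proof -
  define c where "c x = (if x \<in> W then c1 x else k1 + c2 x)" for x
  have "mono_edges E V c \<subseteq> mono_edges E W c1 \<union> mono_edges E (V - W) c2"
  proof
    fix e assume e: "e \<in> mono_edges E V c"
    have eq: "c x = c y" if "x \<in> e" "y \<in> e" for x y
      using e that unfolding mono_edges_def by blast
    have "e \<subseteq> W \<or> e \<subseteq> V - W"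
    proof (rule ccontr)
      assume "\<not> ?thesis"
      then obtain x y where "x \<in> e" "x \<in> W" "y \<in> e" "y \<notin> W"
        using e unfolding mono_edges_def by blast
      then show False using eq[of x y] assms(3)[of x] by (simp add: c_def)
    qed
    then show "e \<in> mono_edges E W c1 \<union> mono_edges E (V - W) c2"
    proof
      assume W: "e \<subseteq> W"
      have "c1 x = c1 y" if "x \<in> e" "y \<in> e" for x y
        using eq[OF that] that W unfolding c_def by (auto split: if_splits)
      then show ?thesis using e W unfolding mono_edges_def by blast
    next
      assume W: "e \<subseteq> V - W"
      have "c2 x = c2 y" if "x \<in> e" "y \<in> e" for x y
        using eq[OF that] that W unfolding c_def by (auto split: if_splits)
      then show ?thesis using e W unfolding mono_edges_def by blast
    qed
  qed
  moreover have "finite W" using assms(1,2) finite_subset by blast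
  ultimately have "card (mono_edges E V c) \<le> card (mono_edges E W c1 \<union> mono_edges E (V - W) c2)"
    using assms(2) by (intro card_mono) (auto simp: finite_mono_edges)
  also have "\<dots> \<le> card (mono_edges E W c1) + card (mono_edges E (V - W) c2)" by (rule card_Un_le)
  finally show ?thesis
    using assms(1,3,4) by (intro exI[of _ c]) (auto simp: c_def trans_less_add1)
qed

text \<open>Induction on \<open>card V\<close> with \<open>k\<close> arbitrary. For
  \<open>k < r * w\<close> the bound is at least \<open>card V ^ 2\<close> and a constant colouring
  will do. An independent set of size at least \<open>(r + 1) * card V / k\<close> gets a colour of
  its own. Without one, \<open>peel\<close> handles at least half of the vertices with a share of
  the colours, and the rest receives the remaining colours by induction.\<close>

lemma colouring_few_mono_edges:
  fixes w :: real
  assumes edges: "\<And>e. e \<in> E \<Longrightarrow> card e = 2"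
    and free: "\<And>xs. cycle_in E xs \<Longrightarrow> length xs \<noteq> 2 * r + 1"
    and r: "r \<ge> 1" and w: "w = 4 * (real r + 1) * (2 * real r - 1)"
    and "finite V" "k \<ge> 1"
  shows "\<exists>c. (\<forall>x\<in>V. c x < k) \<and>
           card (mono_edges E V c) \<le> (r * w) ^ (r + 1) * (real (card V) ^ 2 / real k ^ (r + 1))"
  using assms(5,6)
proof (induction "card V" arbitrary: V k rule: less_induct)
  case less
  note fin = less.prems(1) and k = less.prems(2)
  let ?N = "real (card V)" and ?A = "(r * w) ^ (r + 1)"
  have r0: "real r \<ge> 1" using r by simp
  have w8: "w \<ge> 4 * real r + 4"
    using mult_left_mono[of 1 "2 * real r - 1" "4 * (real r + 1)"] r unfolding w by (simp add: algebra_simps)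
  then have w0: "w > 0" using r0 by linarith
  have A0: "?A \<ge> 0" using w0 by simp
  consider "k < r * w" | "V = {}"
    | I where "r * w \<le> k" "V \<noteq> {}" "I \<subseteq> V" "indep E I" "(real r + 1) * ?N \<le> real k * card I"
    | "r * w \<le> k" "V \<noteq> {}" "\<And>I. I \<subseteq> V \<Longrightarrow> indep E I \<Longrightarrow> real k * card I < (real r + 1) * ?N"
    by (meson not_le)
  then show ?case
  proof cases
    case 1
    have "real k ^ (r + 1) \<le> ?A" using 1 by (intro power_mono) auto
    then have "real k ^ (r + 1) * (?N ^ 2 / real k ^ (r + 1)) \<le> ?A * (?N ^ 2 / real k ^ (r + 1))"
      by (rule mult_right_mono) simp
    then have "?N ^ 2 \<le> ?A * (?N ^ 2 / real k ^ (r + 1))"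
      using k by (simp del: power_Suc)
    moreover have "real (card (mono_edges E V (\<lambda>_. 0 :: nat))) \<le> ?N ^ 2"
      using card_mono_edges_le[OF fin edges] by (metis of_nat_mono of_nat_power)
    ultimately have "real (card (mono_edges E V (\<lambda>_. 0 :: nat))) \<le> ?A * (?N ^ 2 / real k ^ (r + 1))"
      by linarith
    then show ?thesis using k by (intro exI[of _ "\<lambda>_. 0"]) auto
  next
    case 2
    then have "mono_edges E V (\<lambda>_. 0 :: nat) = {}" using edges by (force simp: mono_edges_def)
    then show ?thesis using 2 by (intro exI[of _ "\<lambda>_. 0"]) simp
  next
    case 3
    have "1 * w \<le> r * w" using r w0 by (intro mult_right_mono) auto
    then have k8: "real k \<ge> 4 * real r + 4" using 3(1) w8 by linarith
    then have "real k > 4" using r0 by linarith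
    then have k2: "k \<ge> 2" by linarith
    have finI: "finite I" using 3(3) fin finite_subset by blast
    have "?N > 0" using 3(2) fin by (simp add: card_gt_0_iff)
    then have "(real r + 1) * ?N > 0" by simp
    then have "card I > 0" using 3(5) by (metis mult_zero_right not_le of_nat_0 not_gr_zero)
    then have "I \<noteq> {}" by auto
    then have "V - I \<subset> V" using 3(3) by blast
    then have I: "card (V - I) < card V" using fin by (rule psubset_card_mono[rotated])
    have "k - 1 \<ge> 1" using k2 by simp
    from less.hyps[OF I finite_Diff[OF fin] this]
    obtain c where c: "\<forall>x\<in>V - I. c x < k - 1"
      "card (mono_edges E (V - I) c) \<le> ?A * (real (card (V - I)) ^ 2 / real (k - 1) ^ (r + 1))"
      by blast
    have "mono_edges E I (\<lambda>_. 0 :: nat) = {}"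
    proof -
      have False if "e \<in> E" "e \<subseteq> I" for e
        using edges[OF that(1)] that 3(4) by (auto simp: card_2_iff indep_def)
      then show ?thesis unfolding mono_edges_def by blast
    qed
    then obtain c' where c': "\<forall>x\<in>V. c' x < 1 + (k - 1)"
      "card (mono_edges E V c') \<le> card (mono_edges E (V - I) c)"
      using combine_colourings[OF 3(3) fin, of "\<lambda>_. 0" 1 c "k - 1" E] c(1) by auto
    have cVI: "real (card (V - I)) = ?N - card I"
      using 3(3) finI fin by (simp add: card_Diff_subset card_mono of_nat_diff)
    define q where "q = 1 - 1 / real k"
    have q: "0 < q" "q \<le> 1" using k2 unfolding q_def by auto
    \<comment> \<open>Bernoulli explains the threshold \<open>(r + 1) * ?N / k\<close>: removing the
      set shrinks the vertex count at least by the factor \<open>q ^ (r + 1)\<close>, which pays for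
      the smaller denominator \<open>(k - 1) ^ (r + 1)\<close>.\<close>
    have "1 + real (r + 1) * (- 1 / real k) \<le> (1 + - 1 / real k) ^ (r + 1)"
      using k by (intro Bernoulli_inequality) auto
    then have bern: "1 - (real r + 1) / real k \<le> q ^ (r + 1)" by (simp add: q_def field_simps)
    have "(real r + 1) / real k * ?N \<le> card I" using 3(5) k by (simp add: field_simps)
    then have "real (card (V - I)) \<le> (1 - (real r + 1) / real k) * ?N"
      unfolding cVI by (simp add: algebra_simps)
    also have "\<dots> \<le> q ^ (r + 1) * ?N" using bern by (intro mult_right_mono) auto
    finally have "real (card (V - I)) ^ 2 \<le> (q ^ (r + 1) * ?N) ^ 2" by (intro power_mono) auto
    also have "\<dots> = q ^ (r + 1) * (q ^ (r + 1) * ?N ^ 2)" by (simp add: power2_eq_square algebra_simps)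
    also have "\<dots> \<le> 1 * (q ^ (r + 1) * ?N ^ 2)"
      using q by (intro mult_right_mono power_le_one) auto
    finally have le: "real (card (V - I)) ^ 2 \<le> q ^ (r + 1) * ?N ^ 2" by simp
    have kq: "real (k - 1) = real k * q" using k by (simp add: q_def field_simps of_nat_diff)
    have "real (card (V - I)) ^ 2 / real (k - 1) ^ (r + 1) \<le> q ^ (r + 1) * ?N ^ 2 / real (k - 1) ^ (r + 1)"
      using le by (rule divide_right_mono) simp
    also have "\<dots> = ?N ^ 2 / real k ^ (r + 1)"
      using q k unfolding kq power_mult_distrib by simp
    finally have "?A * (real (card (V - I)) ^ 2 / real (k - 1) ^ (r + 1)) \<le> ?A * (?N ^ 2 / real k ^ (r + 1))"
      using A0 by (rule mult_left_mono)
    then have "card (mono_edges E V c') \<le> ?A * (?N ^ 2 / real k ^ (r + 1))"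
      using c(2) c'(2) by linarith
    then show ?thesis using c'(1) k by (intro exI[of _ c']) auto
  next
    case 4
    \<comment> \<open>\<open>t\<close> makes the part outside \<open>S\<close> at most
      \<open>?N / 2\<close>. \<open>D\<close> is chosen so that \<open>t ^ (r - 1) * D\<close>
      equals \<open>(2 * r - 1) * (r + 1) * ?N / k\<close>, which is what the absence of large
      independent sets gives. \<open>k1\<close> is small enough that
      \<open>(k - k1) ^ (r + 1)\<close> stays above half of \<open>k ^ (r + 1)\<close>.\<close>
    define t where "t = real k / w"
    define D where "D = w ^ r * ?N / (4 * real k ^ r)"
    define k1 where "k1 = k div (2 * (r + 1))"
    have tr: "t \<ge> real r" using 4(1) w0 by (simp add: t_def field_simps)
    then have t1: "t \<ge> 1" using r0 by linarith
    have "1 * w \<le> r * w" using r w0 by (intro mult_right_mono) auto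
    then have "real k \<ge> 4 * real r + 4" using 4(1) w8 by linarith
    then have k4: "k \<ge> 4 * (r + 1)" by (simp flip: of_nat_le_iff[where 'a = real])
    have k1: "1 \<le> k1" using k4 unfolding k1_def by (simp add: div_greater_zero_iff Suc_le_eq)
    have "k < 2 * (r + 1) * (k1 + 1)"
      unfolding k1_def using dividend_less_div_times[of "2 * (r + 1)" k] by (simp add: algebra_simps)
    also have "\<dots> \<le> 2 * (r + 1) * (2 * k1)" using k1 by (intro mult_left_mono) auto
    finally have "real k \<le> 4 * (real r + 1) * k1"
      by (simp flip: of_nat_le_iff[where 'a = real] of_nat_less_iff[where 'a = real] add: algebra_simps)
    then have k1': "1 / real k1 \<le> 4 * (real r + 1) / k" using k1 k by (simp add: field_simps)
    have k1u: "2 * (r + 1) * k1 \<le> k" unfolding k1_def by (rule times_div_less_eq_dividend)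
    have k1k: "k1 < k" using k unfolding k1_def by (intro div_less_dividend) auto
    have small: "real ((2 * r - 1) * card J) \<le> t ^ (r - 1) * D" if "J \<subseteq> V" "indep E J" for J
    proof -
      have "real ((2 * r - 1) * card J) = (2 * real r - 1) * card J" using r by (simp add: of_nat_diff)
      also have "\<dots> \<le> (2 * real r - 1) * ((real r + 1) * ?N / k)"
        using 4(3)[OF that] k r0 by (intro mult_left_mono) (auto simp: field_simps)
      also have "\<dots> = w / 4 * ?N / k" using k by (simp add: w field_simps)
      also have "\<dots> = t ^ (r - 1) * D"
      proof -
        have "w ^ r = w ^ (r - 1) * w" "real k ^ r = real k ^ (r - 1) * k"
          using r by (cases r; simp)+
        then show ?thesis using w0 k unfolding t_def D_def by (simp add: power_divide)
      qed
      finally show ?thesis .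
    qed
    have D0: "D \<ge> 0" using w0 unfolding D_def by simp
    have "\<exists>S I c. S \<subseteq> V \<and> I \<subseteq> V \<and> indep E I \<and> (\<forall>x. c x < k1) \<and>
      card (mono_edges E S c) \<le> card S * (D / k1) \<and> card (V - S) \<le> (t + r) * (2 * real r - 1) * card I"
      by (rule peel[OF _ _ r fin t1 D0 k1]) (fact edges, fact free, rule small)
    then obtain S I c where S: "S \<subseteq> V" "I \<subseteq> V" "indep E I" "\<forall>x. c x < k1"
      "card (mono_edges E S c) \<le> card S * (D / k1)" "card (V - S) \<le> (t + r) * (2 * real r - 1) * card I"
      by blast
    have "card I \<le> (real r + 1) * ?N / k" using 4(3)[OF S(2,3)] k by (simp add: field_simps)
    then have "(t + r) * (2 * real r - 1) * card I \<le> (t + t) * (2 * real r - 1) * ((real r + 1) * ?N / k)"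
      using tr t1 r0 by (intro mult_mono) auto
    also have "\<dots> = t * w * ?N / (2 * k)" using k by (simp add: w field_simps)
    also have "\<dots> = ?N / 2" using w0 k unfolding t_def by simp
    finally have half: "card (V - S) \<le> ?N / 2" using S(6) by linarith
    have "?N > 0" using 4(2) fin by (simp add: card_gt_0_iff)
    then have lt: "card (V - S) < card V" using half by linarith
    have "k - k1 \<ge> 1" using k1k by simp
    from less.hyps[OF lt finite_Diff[OF fin] this]
    obtain c2 where c2: "\<forall>x\<in>V - S. c2 x < k - k1"
      "card (mono_edges E (V - S) c2) \<le> ?A * (real (card (V - S)) ^ 2 / real (k - k1) ^ (r + 1))"
      by blast
    obtain c' where c': "\<forall>x\<in>V. c' x < k1 + (k - k1)"
      "card (mono_edges E V c') \<le> card (mono_edges E S c) + card (mono_edges E (V - S) c2)"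
      using combine_colourings[OF S(1) fin, of c k1 c2 "k - k1" E] c2(1) S(4) by auto
    have "card S \<le> card V" using S(1) fin by (rule card_mono[rotated])
    then have "card S * (D / k1) \<le> ?N * (D * (4 * (real r + 1) / k))"
      using k1' D0 mult_left_mono[OF k1' D0] by (intro mult_mono) auto
    also have "\<dots> = (real r + 1) * w ^ r * (?N ^ 2 / real k ^ (r + 1))"
      using k unfolding D_def by (simp add: power2_eq_square divide_simps)
    also have "\<dots> \<le> ?A / 2 * (?N ^ 2 / real k ^ (r + 1))"
    proof (rule mult_right_mono)
      have "(real r + 1) * w ^ r \<le> w / 2 * w ^ r" using w8 w0 r0 by (intro mult_right_mono) auto
      also have "\<dots> = w ^ (r + 1) / 2" by simp
      also have "\<dots> \<le> ?A / 2"
        using r0 w0 by (simp add: power_mult_distrib del: power_Suc)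
      finally show "(real r + 1) * w ^ r \<le> ?A / 2" .
    qed simp
    finally have part1: "card (mono_edges E S c) \<le> ?A / 2 * (?N ^ 2 / real k ^ (r + 1))"
      using S(5) by linarith
    define q where "q = 1 - 1 / (2 * (real r + 1))"
    have q0: "q > 0" unfolding q_def by (simp add: field_simps)
    have "1 + real (r + 1) * (- 1 / (2 * (real r + 1))) \<le> (1 + - 1 / (2 * (real r + 1))) ^ (r + 1)"
      by (intro Bernoulli_inequality) (simp add: field_simps)
    moreover have "1 + real (r + 1) * (- 1 / (2 * (real r + 1))) = 1 / 2" by (simp add: field_simps)
    moreover have "1 + - 1 / (2 * (real r + 1)) = q" by (simp add: q_def)
    ultimately have qh: "1 / 2 \<le> q ^ (r + 1)" by metis
    have "(2 * (real r + 1)) * k1 \<le> k"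
      using of_nat_mono[OF k1u, where 'a = real] by (simp add: algebra_simps)
    then have "q * k \<le> real (k - k1)"
      using k1k by (simp add: q_def of_nat_diff field_simps)
    then have "(q * k) ^ (r + 1) \<le> real (k - k1) ^ (r + 1)" using q0 by (intro power_mono) auto
    moreover have "1 / 2 * real k ^ (r + 1) \<le> (q * k) ^ (r + 1)"
      unfolding power_mult_distrib using qh by (intro mult_right_mono) auto
    ultimately have kk: "1 / 2 * real k ^ (r + 1) \<le> real (k - k1) ^ (r + 1)" by linarith
    \<comment> \<open>Halving the vertices gains a factor 4 and giving up \<open>k1\<close> colours
      loses at most a factor 2, so the recursive part takes half of the bound; \<open>part1\<close>
      takes the other half.\<close>
    have "real (card (V - S)) ^ 2 / real (k - k1) ^ (r + 1) \<le> (?N / 2) ^ 2 / (1 / 2 * real k ^ (r + 1))"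
      using half kk k by (intro frac_le power_mono) auto
    also have "\<dots> = 1 / 2 * (?N ^ 2 / real k ^ (r + 1))" by (simp add: power_divide)
    finally have "?A * (real (card (V - S)) ^ 2 / real (k - k1) ^ (r + 1)) \<le> ?A * (1 / 2 * (?N ^ 2 / real k ^ (r + 1)))"
      using A0 by (rule mult_left_mono)
    also have "\<dots> = ?A / 2 * (?N ^ 2 / real k ^ (r + 1))" by simp
    finally have part2: "card (mono_edges E (V - S) c2) \<le> ?A / 2 * (?N ^ 2 / real k ^ (r + 1))"
      using c2(2) by linarith
    have "real (card (mono_edges E V c')) \<le> card (mono_edges E S c) + real (card (mono_edges E (V - S) c2))"
      using c'(2) by linarith
    also have "\<dots> \<le> ?A / 2 * (?N ^ 2 / real k ^ (r + 1)) + ?A / 2 * (?N ^ 2 / real k ^ (r + 1))"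
      using part1 part2 by linarith
    also have "\<dots> = ?A * (?N ^ 2 / real k ^ (r + 1))" by (simp only: field_sum_of_halves flip: distrib_right)
    finally show ?thesis using c'(1) k1k by (intro exI[of _ c']) auto
  qed
qed

section \<open>Packings of short odd cycles\<close>

text \<open>Insert common neighbours one at a time: there are more than \<open>2 * m\<close>
  candidates, while the vertices already used together with \<open>b\<close> number at most
  \<open>2 * m\<close>. The vertex \<open>b\<close> is kept free so that it can close the path into
  a cycle.\<close>

lemma interleave_rich_path:
  fixes R :: "('a \<times> 'a) set"
  assumes R: "R \<subseteq> A \<times> B" and disj: "A \<inter> B = {}"
    and "xs \<noteq> []" "distinct xs" "set xs \<subseteq> A" "length xs \<le> m"
    and "successively (\<lambda>x y. 2 * m < card {w. (x, w) \<in> R \<and> (y, w) \<in> R}) xs"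
  shows "\<exists>zs. length zs = 2 * length xs - 1 \<and> distinct zs \<and> set zs \<subseteq> set xs \<union> (B - {b}) \<and>
    hd zs = hd xs \<and> last zs = last xs \<and> zs \<noteq> [] \<and> successively (\<lambda>x y. (x, y) \<in> R \<or> (y, x) \<in> R) zs"
  using assms(3-)
proof (induction xs)
  case (Cons x ys)
  show ?case
  proof (cases ys)
    case Nil
    then show ?thesis by (intro exI[of _ "[x]"]) auto
  next
    case (Cons y ys')
    obtain zs where zs: "length zs = 2 * length ys - 1" "distinct zs" "set zs \<subseteq> set ys \<union> (B - {b})"
      "hd zs = hd ys" "last zs = last ys" "zs \<noteq> []" "successively (\<lambda>x y. (x, y) \<in> R \<or> (y, x) \<in> R) zs"
      using Cons.IH Cons.prems Cons by auto
    let ?W = "{w. (x, w) \<in> R \<and> (y, w) \<in> R}"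
    have W: "2 * m < card ?W" using Cons.prems Cons by simp
    have "card (insert b (set zs)) \<le> Suc (length zs)"
      using card_length[of zs] by (simp add: card_insert_if)
    also have "\<dots> \<le> 2 * m" using zs(1) Cons.prems(4) Cons by simp
    finally have "card (insert b (set zs)) < card ?W" using W by simp
    then have "\<not> ?W \<subseteq> insert b (set zs)"
      using card_mono[of "insert b (set zs)" ?W] by auto
    then obtain w where w: "(x, w) \<in> R" "(y, w) \<in> R" "w \<noteq> b" "w \<notin> set zs" by auto
    have wB: "w \<in> B" using w(1) R by auto
    have xA: "x \<in> A" "x \<notin> set ys" using Cons.prems by auto
    have "x \<noteq> w" "x \<notin> set zs" using xA wB disj zs(3) by auto
    moreover have "length (x # w # zs) = 2 * length (x # ys) - 1" using zs(1) Cons by simp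
    moreover have "set (x # w # zs) \<subseteq> set (x # ys) \<union> (B - {b})" using zs(3) wB w(3) by auto
    moreover have "last (x # w # zs) = last (x # ys)" using zs(5,6) Cons by simp
    moreover have "successively (\<lambda>x y. (x, y) \<in> R \<or> (y, x) \<in> R) (x # w # zs)"
      using zs(4,6,7) w Cons by (auto simp: successively_Cons)
    ultimately show ?thesis using zs(2) w(4)
      by (intro exI[of _ "x # w # zs"]) auto
  qed
qed simp

text \<open>Call two vertices of \<open>A\<close> rich if they have more than \<open>2 * m\<close> common neighbours. A path of \<open>m\<close>
  vertices in the rich graph on the neighbourhood of a single \<open>b\<close> expands to the desired path ending
  in \<open>b\<close>. Otherwise every neighbourhood has a large pairwise poor subset, and double counting
  poor pairs bounds \<open>card R\<close>.\<close>

lemma alternating_path: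
  fixes R :: "('a \<times> 'a) set"
  assumes R: "R \<subseteq> A \<times> B" and fin: "finite A" "finite B" and disj: "A \<inter> B = {}"
    and card: "card A \<le> n" "card B \<le> n" and m: "m \<ge> 1"
    and big: "5 * real m ^ 3 * real n ^ 3 < real (card R) ^ 2"
  shows "\<exists>zs. length zs = 2 * m \<and> distinct zs \<and> set zs \<subseteq> A \<union> B \<and>
    successively (\<lambda>x y. (x, y) \<in> R \<or> (y, x) \<in> R) zs \<and> (hd zs, last zs) \<in> R"
proof (rule ccontr)
  assume none: "\<not> ?thesis"
  define N where "N b = {a. (a, b) \<in> R}" for b
  define com where "com x y = {w. (x, w) \<in> R \<and> (y, w) \<in> R}" for x y
  have NA: "N b \<subseteq> A" for b using R unfolding N_def by auto
  have finN: "finite (N b)" for b using NA fin(1) finite_subset by blast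
  obtain ix :: "'a \<Rightarrow> nat" where ix: "inj_on ix A"
    using ex_bij_betw_finite_nat[OF fin(1)] unfolding bij_betw_def by blast
  have ex: "\<exists>J. J \<subseteq> N b \<and> (\<forall>x\<in>J. \<forall>y\<in>J. x \<noteq> y \<longrightarrow> card (com x y) \<le> 2 * m) \<and> card (N b) \<le> m * card J"
    if b: "b \<in> B" for b
  proof -
    \<comment> \<open>The parameter \<open>m - 1\<close> yields a rich path on \<open>m\<close>
      vertices. Interleaving gives \<open>2 * m - 1\<close> vertices, and \<open>b\<close> is
      adjacent to both ends because these lie in \<open>N b\<close>.\<close>
    consider xs where "length xs = Suc (m - 1)" "set xs \<subseteq> N b" "successively (\<lambda>x y. 2 * m < card (com x y)) xs"
        "sorted_wrt (\<lambda>x y. ix x < ix y) xs"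
      | J where "J \<subseteq> N b" "\<forall>x\<in>J. \<forall>y\<in>J. ix x < ix y \<longrightarrow> \<not> 2 * m < card (com x y)" "card (N b) \<le> (m - 1) * card J"
      using increasing_path_or_antichain[OF finN[of b], of "m - 1" "\<lambda>x y. 2 * m < card (com x y)" ix] by blast
    then show ?thesis
    proof cases
      case 1
      have "distinct xs"
        using 1(4) by (simp add: sorted_wrt_iff_nth_less distinct_conv_nth) (metis less_irrefl nat_neq_iff)
      moreover have "xs \<noteq> []" "length xs = m" using 1(1) m by auto
      ultimately obtain zs where zs: "length zs = 2 * m - 1" "distinct zs" "set zs \<subseteq> set xs \<union> (B - {b})"
        "hd zs = hd xs" "last zs = last xs" "zs \<noteq> []" "successively (\<lambda>x y. (x, y) \<in> R \<or> (y, x) \<in> R) zs"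
        using interleave_rich_path[OF R disj, of xs m b] 1(2,3) NA[of b] unfolding com_def by auto
      have "hd xs \<in> N b" "last xs \<in> N b" using 1(2) \<open>xs \<noteq> []\<close> by auto
      then have hl: "(hd zs, b) \<in> R" "(last zs, b) \<in> R" using zs(4,5) unfolding N_def by auto
      have "b \<notin> set xs" using 1(2) NA[of b] b disj by blast
      then have "distinct (zs @ [b])" using zs(2,3) by auto
      moreover have "set (zs @ [b]) \<subseteq> A \<union> B" using zs(3) 1(2) NA[of b] b by auto
      moreover have "successively (\<lambda>x y. (x, y) \<in> R \<or> (y, x) \<in> R) (zs @ [b])"
        using zs(7) hl by (simp add: successively_append_iff)
      moreover have "length (zs @ [b]) = 2 * m" using zs(1) m by simp
      moreover have "(hd (zs @ [b]), last (zs @ [b])) \<in> R" using hl(1) zs(6) by simp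
      ultimately show ?thesis using none by blast
    next
      case 2
      have sym: "com x y = com y x" for x y unfolding com_def by auto
      have "card (com x y) \<le> 2 * m" if xy: "x \<in> J" "y \<in> J" "x \<noteq> y" for x y
      proof -
        have "ix x \<noteq> ix y" using ix xy 2(1) NA[of b] unfolding inj_on_def by blast
        then show ?thesis using 2(2) xy sym[of x y] by (metis nat_neq_iff not_less)
      qed
      moreover have "card (N b) \<le> m * card J" using 2(3) by (meson diff_le_self le_trans mult_le_mono1)
      ultimately show ?thesis using 2(1) by blast
    qed
  qed
  define J where
    "J b = (SOME J. J \<subseteq> N b \<and> (\<forall>x\<in>J. \<forall>y\<in>J. x \<noteq> y \<longrightarrow> card (com x y) \<le> 2 * m) \<and> card (N b) \<le> m * card J)" for b
  have J: "J b \<subseteq> N b" "\<And>x y. x \<in> J b \<Longrightarrow> y \<in> J b \<Longrightarrow> x \<noteq> y \<Longrightarrow> card (com x y) \<le> 2 * m"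
    "card (N b) \<le> m * card (J b)" if "b \<in> B" for b
    using someI_ex[OF ex[OF that]] unfolding J_def[symmetric] by blast+
  have finJ: "finite (J b)" if "b \<in> B" for b using J(1)[OF that] finN finite_subset by blast
  \<comment> \<open>Double counting: \<open>T\<close> consists of a vertex \<open>b\<close> with an
    ordered pair of distinct vertices of \<open>J b\<close>. Such a pair is poor, so it occurs with
    at most \<open>2 * m\<close> vertices \<open>b\<close>.\<close>
  define T where "T = Sigma B (\<lambda>b. J b \<times> J b - Id)"
  define P where "P = {(x, y) \<in> A \<times> A. card (com x y) \<le> 2 * m}"
  have finP: "finite P" unfolding P_def by (rule finite_subset[of _ "A \<times> A"]) (use fin in auto)
  have comB: "com x y \<subseteq> B" for x y using R unfolding com_def by auto
  have fincom: "finite (com x y)" for x y using comB fin(2) finite_subset by blast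
  have "card T \<le> card (Sigma P (\<lambda>(x, y). com x y))"
  proof (rule card_inj_on_le)
    show "inj_on prod.swap T" by simp
    show "prod.swap ` T \<subseteq> Sigma P (\<lambda>(x, y). com x y)"
    proof
      fix z assume "z \<in> prod.swap ` T"
      then obtain b x y where z: "z = ((x, y), b)" "(b, (x, y)) \<in> T" by force
      then have b: "b \<in> B" and xy: "x \<in> J b" "y \<in> J b" "x \<noteq> y" unfolding T_def by auto
      then have "x \<in> N b" "y \<in> N b" using J(1) by auto
      then have "x \<in> A" "y \<in> A" "b \<in> com x y" using NA[of b] unfolding N_def com_def by auto
      then show "z \<in> Sigma P (\<lambda>(x, y). com x y)"
        using z(1) J(2)[OF b xy] unfolding P_def by auto
    qed
    show "finite (Sigma P (\<lambda>(x, y). com x y))" using finP fincom by auto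
  qed
  also have "\<dots> = (\<Sum>(x, y)\<in>P. card (com x y))"
    using finP fincom by (subst card_SigmaI) (auto simp: case_prod_unfold)
  also have "\<dots> \<le> (\<Sum>z\<in>P. 2 * m)" by (rule sum_mono) (auto simp: P_def)
  also have "\<dots> = card P * (2 * m)" by simp
  also have "\<dots> \<le> card (A \<times> A) * (2 * m)"
    using fin by (intro mult_right_mono card_mono) (auto simp: P_def)
  also have "\<dots> \<le> n * n * (2 * m)"
    unfolding card_cartesian_product using card by (intro mult_right_mono mult_mono) auto
  finally have "real (card T) \<le> real (n * n * (2 * m))" by (rule of_nat_mono)
  then have T: "real (card T) \<le> 2 * m * real n ^ 2" by (simp add: power2_eq_square algebra_simps)
  have cT: "card T = (\<Sum>b\<in>B. card (J b \<times> J b - Id))"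
    unfolding T_def using fin finJ by (subst card_SigmaI) auto
  \<comment> \<open>With \<open>j = card (J b)\<close>, there are \<open>j ^ 2 - j\<close>
    off-diagonal pairs; the linear term is absorbed by \<open>2 * j \<le> j ^ 2 + 1\<close>.\<close>
  have jj: "real (card (J b)) ^ 2 \<le> 2 * real (card (J b \<times> J b - Id)) + 1" if b: "b \<in> B" for b
  proof -
    have "J b \<times> J b \<subseteq> (J b \<times> J b - Id) \<union> (\<lambda>x. (x, x)) ` J b" by auto
    then have "card (J b \<times> J b) \<le> card ((J b \<times> J b - Id) \<union> (\<lambda>x. (x, x)) ` J b)"
      using finJ[OF b] by (intro card_mono) auto
    also have "\<dots> \<le> card (J b \<times> J b - Id) + card ((\<lambda>x. (x, x)) ` J b)" by (rule card_Un_le)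
    also have "\<dots> \<le> card (J b \<times> J b - Id) + card (J b)"
      using finJ[OF b] by (intro add_left_mono card_image_le) auto
    finally have "real (card (J b \<times> J b)) \<le> real (card (J b \<times> J b - Id) + card (J b))" by (rule of_nat_mono)
    then have "real (card (J b)) ^ 2 \<le> card (J b \<times> J b - Id) + card (J b)"
      by (simp add: card_cartesian_product power2_eq_square)
    moreover have "0 \<le> (real (card (J b)) - 1) ^ 2" by simp
    ultimately show ?thesis by (simp add: power2_diff)
  qed
  have "(\<Sum>b\<in>B. real (card (J b)) ^ 2) \<le> (\<Sum>b\<in>B. 2 * real (card (J b \<times> J b - Id)) + 1)"
    by (rule sum_mono) (rule jj)
  also have "\<dots> = 2 * real (card T) + card B" by (simp add: cT sum.distrib sum_distrib_left)
  also have "\<dots> \<le> 4 * m * real n ^ 2 + n" using T card by linarith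
  also have "\<dots> \<le> 5 * m * real n ^ 2"
  proof -
    have "n * 1 \<le> n * (n * m)" using m by (cases "n = 0") auto
    then have "real (n * 1) \<le> real (n * (n * m))" by (rule of_nat_mono)
    then show ?thesis by (simp add: power2_eq_square algebra_simps)
  qed
  finally have sq: "(\<Sum>b\<in>B. real (card (J b)) ^ 2) \<le> 5 * m * real n ^ 2" .
  have "card R \<le> card (Sigma B N)"
  proof (rule card_inj_on_le)
    show "inj_on prod.swap R" by simp
    show "prod.swap ` R \<subseteq> Sigma B N" using R unfolding N_def by auto
    show "finite (Sigma B N)" using fin finN by auto
  qed
  also have "\<dots> = (\<Sum>b\<in>B. card (N b))" using fin finN by (subst card_SigmaI) auto
  also have "\<dots> \<le> (\<Sum>b\<in>B. m * card (J b))" by (rule sum_mono) (rule J(3))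
  finally have "real (card R) \<le> real (\<Sum>b\<in>B. m * card (J b))" by (rule of_nat_mono)
  then have "real (card R) \<le> m * (\<Sum>b\<in>B. real (card (J b)))" by (simp add: sum_distrib_left)
  then have "real (card R) ^ 2 \<le> (m * (\<Sum>b\<in>B. real (card (J b)))) ^ 2" by (intro power_mono) auto
  also have "\<dots> = real m ^ 2 * (\<Sum>b\<in>B. real (card (J b))) ^ 2" by (simp add: power_mult_distrib)
  \<comment> \<open>Cauchy-Schwarz passes from the sum of the sizes to the sum of their
    squares.\<close>
  also have "\<dots> \<le> real m ^ 2 * ((\<Sum>b\<in>B. real (card (J b)) ^ 2) * card B)"
    by (intro mult_left_mono sum_squared_le_sum_of_squares) auto
  also have "\<dots> \<le> real m ^ 2 * (5 * m * real n ^ 2 * n)"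
    using sq card by (intro mult_left_mono mult_mono) (auto intro: sum_nonneg)
  also have "\<dots> = 5 * real m ^ 3 * real n ^ 3" by (simp add: power2_eq_square power3_eq_cube algebra_simps)
  finally show False using big by simp
qed

text \<open>Average over all maps from \<open>V\<close> to three classes: the vertices of a list are
  distinct, so a given list is respected by at least a proportion \<open>1 / 3 ^ L\<close> of the
  maps. The \<open>min\<close> puts the first two vertices into classes 0 and 1 and all later ones
  into class 2.\<close>

lemma tripartite_selection:
  assumes V: "finite V" and M: "finite M"
    and lists: "\<And>xs. xs \<in> M \<Longrightarrow> distinct xs \<and> set xs \<subseteq> V \<and> length xs = L"
  shows "\<exists>p. card M \<le> 3 ^ L * card {xs \<in> M. \<forall>i<L. p (xs ! i) = min i (2 :: nat)}"
proof (rule ccontr)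
  assume none: "\<not> ?thesis"
  let ?good = "\<lambda>p xs. \<forall>i<L. p (xs ! i) = min i (2 :: nat)"
  define P where "P = PiE V (\<lambda>_. {..<3 :: nat})"
  have finP: "finite P" unfolding P_def using V by (intro finite_PiE) auto
  have cP: "card P = 3 ^ card V" unfolding P_def using V by (simp add: card_PiE)
  have lower: "3 ^ card V \<le> 3 ^ L * card {p \<in> P. ?good p xs}" if xs: "xs \<in> M" for xs
  proof -
    have d: "distinct xs" "set xs \<subseteq> V" "length xs = L" using lists[OF xs] by auto
    \<comment> \<open>The values allowed at \<open>v\<close>: a single one on the list, all three
      elsewhere. Every map in the product of these sets respects \<open>xs\<close>.\<close>
    define T where "T v = (if v \<in> set xs then {min i 2 | i. i < L \<and> xs ! i = v} else {..<3 :: nat})" for v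
    have T1: "T (xs ! i) = {min i 2}" if "i < L" for i
      using that d unfolding T_def by (auto simp: nth_eq_iff_index_eq)
    have "PiE V T \<subseteq> {p \<in> P. ?good p xs}"
    proof
      fix p assume p: "p \<in> PiE V T"
      have "T v \<subseteq> {..<3}" for v unfolding T_def by auto
      then have "p \<in> P" using p unfolding P_def by (auto simp: PiE_iff)
      moreover have "p (xs ! i) = min i 2" if "i < L" for i
      proof -
        have "xs ! i \<in> V" using that d by auto
        then have "p (xs ! i) \<in> T (xs ! i)" using p by (auto simp: PiE_iff)
        then show ?thesis using T1[OF that] by simp
      qed
      ultimately show "p \<in> {p \<in> P. ?good p xs}" by simp
    qed
    then have "card (PiE V T) \<le> card {p \<in> P. ?good p xs}" using finP by (intro card_mono) auto
    moreover have "card (PiE V T) = 3 ^ (card V - L)"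
    proof -
      have "card (PiE V T) = (\<Prod>v\<in>V. card (T v))" using V by (rule card_PiE)
      also have "\<dots> = (\<Prod>v\<in>V - set xs. card (T v)) * (\<Prod>v\<in>set xs. card (T v))"
        using V d(2) by (rule prod.subset_diff[rotated])
      also have "(\<Prod>v\<in>set xs. card (T v)) = (\<Prod>v\<in>set xs. 1)"
        using T1 d(3) by (intro prod.cong) (auto simp: in_set_conv_nth)
      also have "(\<Prod>v\<in>V - set xs. card (T v)) = (\<Prod>v\<in>V - set xs. 3)"
        by (intro prod.cong) (auto simp: T_def)
      also have "card (V - set xs) = card V - L"
        using d by (simp add: card_Diff_subset distinct_card)
      then have "(\<Prod>v\<in>V - set xs. 3) * (\<Prod>v\<in>set xs. 1) = (3 :: nat) ^ (card V - L)" by simp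
      finally show ?thesis .
    qed
    moreover have "L \<le> card V" using d V by (metis card_mono distinct_card)
    then have "(3 :: nat) ^ card V = 3 ^ L * 3 ^ (card V - L)" by (simp flip: power_add)
    ultimately show ?thesis by simp
  qed
  have "P \<noteq> {}" unfolding P_def by (auto simp: PiE_eq_empty_iff lessThan_empty_iff)
  have "card M * 3 ^ card V = (\<Sum>xs\<in>M. 3 ^ card V)" by simp
  also have "\<dots> \<le> (\<Sum>xs\<in>M. 3 ^ L * card {p \<in> P. ?good p xs})" by (rule sum_mono) (rule lower)
  also have "\<dots> = 3 ^ L * (\<Sum>xs\<in>M. card {p \<in> P. ?good p xs})" by (simp add: sum_distrib_left)
  also have "(\<Sum>xs\<in>M. card {p \<in> P. ?good p xs}) = (\<Sum>p\<in>P. card {xs \<in> M. ?good p xs})"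
    using sum.swap_restrict[OF M finP, of "\<lambda>_ _. 1 :: nat" "\<lambda>xs p. ?good p xs"] by simp
  also have "3 ^ L * (\<Sum>p\<in>P. card {xs \<in> M. ?good p xs}) = (\<Sum>p\<in>P. 3 ^ L * card {xs \<in> M. ?good p xs})"
    by (simp add: sum_distrib_left)
  also have "\<dots> < (\<Sum>p\<in>P. card M)"
    using none finP \<open>P \<noteq> {}\<close> by (intro sum_strict_mono) (auto simp: not_le)
  also have "\<dots> = card M * 3 ^ card V" by (simp add: cP)
  finally show False by simp
qed

text \<open>Remove cycles greedily; as \<open>l \<ge> 1\<close>, each one contains an edge and the
  edge count drops.\<close>

lemma edge_disjoint_packing:
  assumes "finite E" "l \<ge> 1"
  shows "\<exists>M. finite M \<and> (\<forall>xs\<in>M. cycle_in E xs \<and> length xs = l) \<and>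
    pairwise (\<lambda>xs ys. cycle_edges xs \<inter> cycle_edges ys = {}) M \<and>
    (\<forall>ys. cycle_in (E - \<Union> (cycle_edges ` M)) ys \<longrightarrow> length ys \<noteq> l)"
  using assms(1)
proof (induction "card E" arbitrary: E rule: less_induct)
  case less
  show ?case
  proof (cases "\<exists>xs. cycle_in E xs \<and> length xs = l")
    case False
    then show ?thesis by (intro exI[of _ "{}"]) auto
  next
    case True
    then obtain xs where xs: "cycle_in E xs" "length xs = l" by blast
    let ?E = "E - cycle_edges xs"
    have sub: "cycle_edges xs \<subseteq> E" using xs(1) by (simp add: cycle_in_def)
    have "cycle_edges xs \<noteq> {}" using xs(2) assms(2) by (auto simp: cycle_edges_def lessThan_empty_iff)
    then have "?E \<subset> E" using sub by blast
    then have "card ?E < card E" using less.prems by (rule psubset_card_mono[rotated])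
    from less.hyps[OF this finite_Diff[OF less.prems]]
    obtain M where M: "finite M" "\<forall>ys\<in>M. cycle_in ?E ys \<and> length ys = l"
      "pairwise (\<lambda>xs ys. cycle_edges xs \<inter> cycle_edges ys = {}) M"
      "\<forall>ys. cycle_in (?E - \<Union> (cycle_edges ` M)) ys \<longrightarrow> length ys \<noteq> l"
      by blast
    have "\<forall>ys\<in>insert xs M. cycle_in E ys \<and> length ys = l"
      using M(2) xs unfolding cycle_in_def by blast
    moreover have "pairwise (\<lambda>xs ys. cycle_edges xs \<inter> cycle_edges ys = {}) (insert xs M)"
      using M(2,3) unfolding pairwise_insert cycle_in_def by blast
    moreover have "E - \<Union> (cycle_edges ` insert xs M) = ?E - \<Union> (cycle_edges ` M)" by auto
    ultimately show ?thesis using M(1,4) by (intro exI[of _ "insert xs M"]) simp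
  qed
qed

text \<open>After selecting a tripartition, each cycle of \<open>M'\<close> contributes its first edge to a bipartite
  graph \<open>R\<close> and keeps its other vertices outside. A cycle of length \<open>2 * (r - l + 1)\<close> in \<open>R\<close>, merged along
  one of its edges with the member of \<open>M'\<close> through that edge, has length \<open>2 * r + 1\<close>.\<close>

lemma packing_bound:
  assumes V: "finite V" and EV: "\<And>e. e \<in> E \<Longrightarrow> e \<subseteq> V"
    and free: "\<And>xs. cycle_in E xs \<Longrightarrow> length xs \<noteq> 2 * r + 1"
    and l: "1 \<le> l" "l < r" and M: "finite M"
    and cyc: "\<And>xs. xs \<in> M \<Longrightarrow> cycle_in E xs \<and> length xs = 2 * l + 1"
    and disj: "pairwise (\<lambda>xs ys. cycle_edges xs \<inter> cycle_edges ys = {}) M"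
  shows "card M \<le> 3 ^ (2 * l + 1) * sqrt (5 * real (r - l + 1) ^ 3 * real (card V) ^ 3)"
proof -
  let ?L = "2 * l + 1"
  have inV: "set xs \<subseteq> V" if xs: "xs \<in> M" for xs
  proof
    fix v assume "v \<in> set xs"
    then obtain i where i: "i < length xs" "xs ! i = v" by (auto simp: in_set_conv_nth)
    have "{xs ! i, xs ! (Suc i mod length xs)} \<in> E"
      using cyc[OF xs] i(1) unfolding cycle_in_def cycle_edges_def by blast
    then show "v \<in> V" using EV i(2) by blast
  qed
  obtain p where p: "card M \<le> 3 ^ ?L * card {xs \<in> M. \<forall>i<?L. p (xs ! i) = min i (2 :: nat)}"
    using tripartite_selection[OF V M, of ?L] cyc inV unfolding cycle_in_def by blast
  define M' where "M' = {xs \<in> M. \<forall>i<?L. p (xs ! i) = min i (2 :: nat)}"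
  have M'M: "M' \<subseteq> M" unfolding M'_def by auto
  have shape: "\<exists>a b c zs. xs = a # b # c # zs \<and> p a = 0 \<and> p b = 1 \<and> (\<forall>v\<in>set (c # zs). p v = 2)"
    if xs: "xs \<in> M'" for xs
  proof -
    have len: "length xs = ?L" and pi: "\<And>i. i < ?L \<Longrightarrow> p (xs ! i) = min i 2"
      using xs cyc unfolding M'_def by auto
    obtain a b c zs where s: "xs = a # b # c # zs"
      using len l(1) by (cases xs; cases "tl xs"; cases "tl (tl xs)") auto
    have "p a = 0" "p b = 1" using pi[of 0] pi[of 1] l(1) by (auto simp: s)
    moreover have "p v = 2" if v: "v \<in> set (c # zs)" for v
    proof -
      obtain i where "i < length (c # zs)" "(c # zs) ! i = v" using v by (metis in_set_conv_nth)
      then show ?thesis using pi[of "i + 2"] len by (simp add: s)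
    qed
    ultimately show ?thesis using s by blast
  qed
  define R where "R = (\<lambda>xs. (xs ! 0, xs ! 1)) ` M'"
  \<comment> \<open>Two members with the same first edge would not be edge-disjoint, so
    \<open>R\<close> is as large as \<open>M'\<close>.\<close>
  have "inj_on (\<lambda>xs. (xs ! 0, xs ! 1)) M'"
  proof (rule inj_onI)
    fix xs ys assume xy: "xs \<in> M'" "ys \<in> M'" "(xs ! 0, xs ! 1) = (ys ! 0, ys ! 1)"
    have "{xs ! 0, xs ! 1} \<in> cycle_edges xs" if "xs \<in> M'" for xs
      using cyc[of xs] that l(1) M'M unfolding cycle_edges_def by (intro image_eqI[of _ _ 0]) auto
    from this[OF xy(1)] this[OF xy(2)] xy(3) have "cycle_edges xs \<inter> cycle_edges ys \<noteq> {}" by auto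
    then show "xs = ys" using disj xy(1,2) M'M unfolding pairwise_def by blast
  qed
  then have cR: "card R = card M'" unfolding R_def by (rule card_image)
  define A where "A = {v \<in> V. p v = 0}"
  define B where "B = {v \<in> V. p v = 1}"
  have RAB: "R \<subseteq> A \<times> B"
  proof -
    have "xs ! 0 \<in> A \<and> xs ! 1 \<in> B" if "xs \<in> M'" for xs
      using shape[OF that] inV[of xs] M'M that unfolding A_def B_def by fastforce
    then show ?thesis unfolding R_def by auto
  qed
  have "real (card R) ^ 2 \<le> 5 * real (r - l + 1) ^ 3 * real (card V) ^ 3"
  proof (rule ccontr)
    assume "\<not> ?thesis"
    then have big: "5 * real (r - l + 1) ^ 3 * real (card V) ^ 3 < real (card R) ^ 2" by simp
    have "finite A" "finite B" "A \<inter> B = {}" "card A \<le> card V" "card B \<le> card V"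
      using V by (auto simp: A_def B_def intro: card_mono)
    \<comment> \<open>The value \<open>m = r - l + 1\<close> is forced by
      \<open>2 * m + (2 * l - 1) = 2 * r + 1\<close>: the merged cycle consists of \<open>zs\<close>
      and all but two vertices of a member of \<open>M'\<close>.\<close>
    from alternating_path[OF RAB this _ big]
    obtain zs where zs: "length zs = 2 * (r - l + 1)" "distinct zs" "set zs \<subseteq> A \<union> B"
      "successively (\<lambda>x y. (x, y) \<in> R \<or> (y, x) \<in> R) zs" "(hd zs, last zs) \<in> R"
      by auto
    \<comment> \<open>The closing pair of \<open>zs\<close> lies in \<open>R\<close>, so it is the
      first edge of some \<open>xs\<close>. It is replaced by the rest of \<open>xs\<close>, which
      lies in class 2 and therefore misses \<open>zs\<close>.\<close>
    then obtain xs where xs: "xs \<in> M'" "hd zs = xs ! 0" "last zs = xs ! 1" unfolding R_def by auto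
    obtain a b c ys where s: "xs = a # b # c # ys" "\<forall>v\<in>set (c # ys). p v = 2"
      using shape[OF xs(1)] by blast
    have cyc_xs: "cycle_in E xs" "length xs = ?L" using cyc xs(1) M'M by auto
    then have sx: "successively (\<lambda>x y. {x, y} \<in> E) xs" "{last xs, hd xs} \<in> E" "distinct xs"
      using cycle_edges_conv[of xs E] s(1) unfolding cycle_in_def by auto
    have RE: "{x, y} \<in> E" if xy: "(x, y) \<in> R" for x y
    proof -
      obtain us where us: "us \<in> M'" "x = us ! 0" "y = us ! 1" using xy unfolding R_def by auto
      then have "successively (\<lambda>x y. {x, y} \<in> E) us"
        using cyc[of us] cycle_edges_conv[of us E] M'M unfolding cycle_in_def by fastforce
      then show ?thesis using shape[OF us(1)] us(2,3) by auto
    qed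
    have zne: "zs \<noteq> []" using zs(1) by auto
    have "successively (\<lambda>x y. {x, y} \<in> E) zs"
      using zs(4) by (rule successively_mono) (metis RE insert_commute)
    moreover have "{last zs, c} \<in> E" using sx(1) s(1) xs(3) by simp
    ultimately have "successively (\<lambda>x y. {x, y} \<in> E) (zs @ c # ys)"
      using sx(1) s(1) by (simp add: successively_append_iff)
    moreover have "{last (zs @ c # ys), hd (zs @ c # ys)} \<in> E"
      using sx(2) s(1) xs(2) zne by simp
    ultimately have "cycle_edges (zs @ c # ys) \<subseteq> E"
      using cycle_edges_conv[of "zs @ c # ys" E] by simp
    moreover have "distinct (zs @ c # ys)"
      using zs(2,3) sx(3) s unfolding A_def B_def by fastforce
    ultimately have "cycle_in E (zs @ c # ys)" unfolding cycle_in_def by blast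
    moreover have "length (zs @ c # ys) = 2 * r + 1" using zs(1) cyc_xs(2) s(1) l by simp
    ultimately show False using free by blast
  qed
  then have "real (card R) \<le> sqrt (5 * real (r - l + 1) ^ 3 * real (card V) ^ 3)" by (rule real_le_rsqrt)
  moreover have "real (card M) \<le> real (3 ^ ?L * card M')" using p unfolding M'_def by (rule of_nat_mono)
  ultimately show ?thesis unfolding cR by (simp add: mult_left_mono order_trans[OF _ mult_left_mono])
qed

section \<open>The extremal functions\<close>

lemma h_graph_le_mono_edges:
  assumes G: "simple_graph (V, E)" "k \<ge> 1" and c: "\<And>x. x \<in> V \<Longrightarrow> c x < k"
  shows "h_graph (V, E) k \<le> card (mono_edges E V c)"
proof (rule h_graph_attained(2)[OF G])
  show "mono_edges E V c \<subseteq> edges (V, E)" by (auto simp: mono_edges_def)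
  have "c u \<noteq> c v" if "{u, v} \<in> E - mono_edges E V c" for u v
    using that G(1) unfolding mono_edges_def simple_graph_def by fastforce
  then show "colorable k (verts (V, E), edges (V, E) - mono_edges E V c)"
    using c unfolding colorable_def by (intro exI[of _ c]) auto
qed

lemma h_graph_delete_edges:
  assumes G: "simple_graph (V, E)" "k \<ge> 1" and D: "D \<subseteq> E"
  shows "h_graph (V, E) k \<le> h_graph (V, E - D) k + card D"
proof -
  have "simple_graph (V, E - D)" using G(1) unfolding simple_graph_def by auto
  from h_graph_attained(1)[OF this G(2)]
  obtain F where F: "F \<subseteq> E - D" "colorable k (V, E - D - F)" "card F = h_graph (V, E - D) k" by auto
  have "E - D - F = E - (F \<union> D)" by auto
  then have "h_graph (V, E) k \<le> card (F \<union> D)"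
    using h_graph_attained(2)[OF G, of "F \<union> D"] F D by auto
  also have "\<dots> \<le> card F + card D" by (rule card_Un_le)
  finally show ?thesis using F(3) by simp
qed

lemma h_max_attained:
  assumes "k \<ge> 1" "\<forall>H\<in>\<H>. edges H \<noteq> {}"
  obtains V :: "nat set" and E where "simple_graph (V, E)" "card V = n" "free_of \<H> (V, E)" "h_max n k \<H> = h_graph (V, E) k"
proof -
  have "h_max n k \<H> \<in> h_values n k \<H>"
    unfolding h_max_def using finite_h_values[OF assms(1)] h_values_nonempty[of \<H>] assms(2) by (intro Max_in) blast+
  then obtain G :: "nat ugraph" where G: "simple_graph G" "card (verts G) = n" "free_of \<H> G" "h_max n k \<H> = h_graph G k"
    unfolding h_values_def by blast
  show ?thesis by (rule that[of "verts G" "edges G"]) (use G in simp_all)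
qed

lemma h_graph_le_h_max:
  fixes V :: "nat set"
  assumes "k \<ge> 1" "simple_graph (V, E)" "card V = n" "free_of \<H> (V, E)"
  shows "h_graph (V, E) k \<le> h_max n k \<H>"
proof -
  have "h_graph (V, E) k \<in> h_values n k \<H>"
    unfolding h_values_def mem_Collect_eq by (rule exI[of _ "(V, E)"]) (use assms(2-4) in simp)
  then show ?thesis unfolding h_max_def by (rule Max_ge[OF finite_h_values[OF assms(1)]])
qed

lemma edges_cycle_graph:
  assumes "l \<ge> 1"
  shows "edges (cycle_graph l) \<noteq> {}"
proof -
  have "0 < l" using assms by simp
  then have "{0, (0 + 1) mod l} \<in> edges (cycle_graph l)" unfolding cycle_graph_def snd_conv by blast
  then show ?thesis by blast
qed

text \<open>Every vertex of a cycle lies on an edge, hence in \<open>V\<close>, so the vertex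
  condition of \<open>contains_copy_cycle\<close> is automatic.\<close>

lemma no_copy_cycle_iff:
  assumes "simple_graph (V, E)"
  shows "\<not> contains_copy (V, E) (cycle_graph l) \<longleftrightarrow> (\<forall>xs. cycle_in E xs \<longrightarrow> length xs \<noteq> l)"
proof -
  have "set xs \<subseteq> V" if "cycle_in E xs" for xs
  proof
    fix v assume "v \<in> set xs"
    then obtain i where i: "i < length xs" "xs ! i = v" by (auto simp: in_set_conv_nth)
    have "{xs ! i, xs ! (Suc i mod length xs)} \<in> E"
      using that i(1) unfolding cycle_in_def cycle_edges_def by blast
    then show "v \<in> V" using assms i(2) unfolding simple_graph_def by auto
  qed
  then show ?thesis unfolding contains_copy_cycle by blast
qed

text \<open>For each \<open>l\<close> in \<open>{1..<r}\<close> delete all edges of a maximal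
  packing; maximality leaves no cycle of length \<open>2 * l + 1\<close>, and length
  \<open>2 * r + 1\<close> is absent from the start. The bound multiplies at most \<open>r\<close>
  lengths, at most \<open>2 * r + 1\<close> edges per cycle and the estimate of
  \<open>packing_bound\<close>.\<close>

lemma make_odd_cycle_free:
  assumes G: "simple_graph (V, E)"
    and free: "\<And>xs. cycle_in E xs \<Longrightarrow> length xs \<noteq> 2 * r + 1"
  shows "\<exists>D\<subseteq>E. free_of (odd_cycles_upto r) (V, E - D) \<and>
    card D \<le> r * (2 * real r + 1) * 3 ^ (2 * r + 1) * sqrt (5 * real r ^ 3) * sqrt (real (card V) ^ 3)"
proof -
  have finE: "finite E" using finite_edges[OF G] by simp
  have V: "finite V" and EV: "\<And>e. e \<in> E \<Longrightarrow> e \<subseteq> V" using G unfolding simple_graph_def by auto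
  define M where "M l = (SOME M. finite M \<and> (\<forall>xs\<in>M. cycle_in E xs \<and> length xs = 2 * l + 1) \<and>
    pairwise (\<lambda>xs ys. cycle_edges xs \<inter> cycle_edges ys = {}) M \<and>
    (\<forall>ys. cycle_in (E - \<Union> (cycle_edges ` M)) ys \<longrightarrow> length ys \<noteq> 2 * l + 1))" for l
  have M: "finite (M l)" "\<And>xs. xs \<in> M l \<Longrightarrow> cycle_in E xs \<and> length xs = 2 * l + 1"
    "pairwise (\<lambda>xs ys. cycle_edges xs \<inter> cycle_edges ys = {}) (M l)"
    "\<And>ys. cycle_in (E - \<Union> (cycle_edges ` M l)) ys \<Longrightarrow> length ys \<noteq> 2 * l + 1" for l
    using someI_ex[OF edge_disjoint_packing[OF finE, of "2 * l + 1"]] unfolding M_def[symmetric] by auto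
  define D where "D = (\<Union>l\<in>{1..<r}. \<Union> (cycle_edges ` M l))"
  have DE: "D \<subseteq> E" using M(2) unfolding D_def cycle_in_def by blast
  have "simple_graph (V, E - D)" using G unfolding simple_graph_def by auto
  have cyc: "length xs \<noteq> 2 * i + 1" if xs: "cycle_in (E - D) xs" and i: "1 \<le> i" "i \<le> r" for xs i
  proof (cases "i = r")
    case True
    then show ?thesis using free xs unfolding cycle_in_def by blast
  next
    case False
    then have "i \<in> {1..<r}" using i by simp
    then have "\<Union> (cycle_edges ` M i) \<subseteq> D" unfolding D_def by blast
    then have "cycle_in (E - \<Union> (cycle_edges ` M i)) xs" using xs unfolding cycle_in_def by blast
    then show ?thesis by (rule M(4))
  qed
  have "\<not> contains_copy (V, E - D) (cycle_graph (2 * i + 1))" if "1 \<le> i" "i \<le> r" for i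
    unfolding no_copy_cycle_iff[OF \<open>simple_graph (V, E - D)\<close>] using cyc[OF _ that] by blast
  then have "free_of (odd_cycles_upto r) (V, E - D)"
    unfolding free_of_def odd_cycles_upto_def by blast
  let ?K = "3 ^ (2 * r + 1) * (sqrt (5 * real r ^ 3) * sqrt (real (card V) ^ 3))"
  have bound: "real (card (\<Union> (cycle_edges ` M l))) \<le> (2 * real r + 1) * ?K" if l: "l \<in> {1..<r}" for l
  proof -
    have "card (M l) \<le> 3 ^ (2 * l + 1) * sqrt (5 * real (r - l + 1) ^ 3 * real (card V) ^ 3)"
      by (rule packing_bound[OF V EV free _ _ M(1) M(2) M(3)]) (use l in auto)
    \<comment> \<open>As \<open>1 \<le> l < r\<close>, also \<open>r - l + 1 \<le> r\<close>, so a
      single constant covers all lengths.\<close>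
    also have "\<dots> \<le> 3 ^ (2 * r + 1) * sqrt (5 * real r ^ 3 * real (card V) ^ 3)"
      using l by (intro mult_mono power_increasing real_sqrt_le_mono mult_right_mono mult_left_mono power_mono) auto
    also have "\<dots> = ?K" by (simp add: real_sqrt_mult)
    finally have cM: "real (card (M l)) \<le> ?K" .
    have "card (\<Union> (cycle_edges ` M l)) \<le> (\<Sum>xs\<in>M l. card (cycle_edges xs))"
      using M(1) by (rule card_UN_le)
    also have "\<dots> \<le> (\<Sum>xs\<in>M l. 2 * r + 1)"
      using card_cycle_edges M(2) l by (intro sum_mono) (fastforce intro: order_trans)
    also have "\<dots> = (2 * r + 1) * card (M l)" by simp
    finally have "real (card (\<Union> (cycle_edges ` M l))) \<le> real ((2 * r + 1) * card (M l))" by (rule of_nat_mono)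
    also have "\<dots> = (2 * real r + 1) * card (M l)" by (simp add: algebra_simps)
    also have "\<dots> \<le> (2 * real r + 1) * ?K" using cM by (intro mult_left_mono) auto
    finally show ?thesis .
  qed
  have "card D \<le> (\<Sum>l\<in>{1..<r}. card (\<Union> (cycle_edges ` M l)))"
    unfolding D_def by (rule card_UN_le) simp
  then have "real (card D) \<le> real (\<Sum>l\<in>{1..<r}. card (\<Union> (cycle_edges ` M l)))" by (rule of_nat_mono)
  also have "\<dots> = (\<Sum>l\<in>{1..<r}. real (card (\<Union> (cycle_edges ` M l))))" by simp
  also have "\<dots> \<le> (\<Sum>l\<in>{1..<r}. (2 * real r + 1) * ?K)" by (rule sum_mono) (rule bound)
  also have "\<dots> = real (r - 1) * ((2 * real r + 1) * ?K)" by simp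
  also have "\<dots> \<le> real r * ((2 * real r + 1) * ?K)" by (intro mult_right_mono) auto
  finally have "card D \<le> r * (2 * real r + 1) * 3 ^ (2 * r + 1) * sqrt (5 * real r ^ 3) * sqrt (real (card V) ^ 3)"
    by (simp add: mult.assoc)
  then show ?thesis using DE \<open>free_of (odd_cycles_upto r) (V, E - D)\<close> by blast
qed

theorem theorem1p3:
  fixes r :: nat
  assumes "r \<ge> 1"
  shows "\<exists>A :: real. \<forall>n k :: nat. 1 \<le> k \<and> k \<le> n \<longrightarrow>
           \<bar>real (h_max n k {cycle_graph (2 * r + 1)}) - real (h_max n k (odd_cycles_upto r))\<bar>
             \<le> A * real n powr (3 / 2) \<and>
           real (h_max n k {cycle_graph (2 * r + 1)}) \<le> A * (real n ^ 2 / real k ^ (r + 1))"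
proof -
  define w where "w = 4 * (real r + 1) * (2 * real r - 1)"
  \<comment> \<open>\<open>A1\<close> comes from \<open>make_odd_cycle_free\<close> and
    \<open>A2\<close> from \<open>colouring_few_mono_edges\<close>; their maximum serves both
    estimates.\<close>
  define A1 where "A1 = r * (2 * real r + 1) * 3 ^ (2 * r + 1) * sqrt (5 * real r ^ 3)"
  define A2 where "A2 = (r * w) ^ (r + 1)"
  show ?thesis
  proof (intro exI[of _ "max A1 A2"] allI impI, elim conjE)
    fix n k :: nat
    assume k: "1 \<le> k" and "k \<le> n"
    let ?h = "h_max n k {cycle_graph (2 * r + 1)}" and ?h' = "h_max n k (odd_cycles_upto r)"
    have ne: "\<forall>H\<in>{cycle_graph (2 * r + 1)}. edges H \<noteq> {}" using edges_cycle_graph[of "2 * r + 1"] by simp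
    obtain V :: "nat set" and E where G: "simple_graph (V, E)" "card V = n"
      "free_of {cycle_graph (2 * r + 1)} (V, E)"
      "?h = h_graph (V, E) k"
      by (rule h_max_attained[OF k ne, of n]) (rule that)
    have free: "length xs \<noteq> 2 * r + 1" if "cycle_in E xs" for xs
      using G(3) that no_copy_cycle_iff[OF G(1)] unfolding free_of_def by auto
    have edges: "card e = 2" if "e \<in> E" for e using G(1) that unfolding simple_graph_def by auto
    have V: "finite V" using G(1) unfolding simple_graph_def by auto
    \<comment> \<open>As \<open>r \<ge> 1\<close>, the single forbidden cycle belongs to the family,
      so every graph counted in \<open>?h'\<close> is counted in \<open>?h\<close> as well.\<close>
    have "?h' \<le> ?h"
    proof -
      have ne': "\<forall>H\<in>odd_cycles_upto r. edges H \<noteq> {}"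
        using edges_cycle_graph unfolding odd_cycles_upto_def by fastforce
      obtain V' :: "nat set" and E' where G': "simple_graph (V', E')" "card V' = n" "free_of (odd_cycles_upto r) (V', E')"
        "?h' = h_graph (V', E') k"
        by (rule h_max_attained[OF k ne', of n]) (rule that)
      have "cycle_graph (2 * r + 1) \<in> odd_cycles_upto r" using assms unfolding odd_cycles_upto_def by blast
      then have "free_of {cycle_graph (2 * r + 1)} (V', E')" using G'(3) unfolding free_of_def by blast
      then show ?thesis using h_graph_le_h_max[OF k G'(1,2)] G'(4) by metis
    qed
    obtain D where D: "D \<subseteq> E" "free_of (odd_cycles_upto r) (V, E - D)"
      "card D \<le> r * (2 * real r + 1) * 3 ^ (2 * r + 1) * sqrt (5 * real r ^ 3) * sqrt (real (card V) ^ 3)"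
      using make_odd_cycle_free[OF G(1) free] by blast
    have "simple_graph (V, E - D)" using G(1) unfolding simple_graph_def by auto
    then have "h_graph (V, E - D) k \<le> ?h'" using h_graph_le_h_max[OF k _ G(2) D(2)] by blast
    then have "?h \<le> ?h' + card D" using h_graph_delete_edges[OF G(1) k D(1)] G(4) by linarith
    have "sqrt (real n ^ 3) = real n powr (3 / 2)"
      by (cases "n = 0") (simp_all add: powr_half_sqrt[symmetric] powr_powr flip: powr_numeral)
    then have "card D \<le> A1 * real n powr (3 / 2)" using D(3) G(2) unfolding A1_def by simp
    also have "\<dots> \<le> max A1 A2 * real n powr (3 / 2)" by (intro mult_right_mono) auto
    finally have diff: "\<bar>real ?h - real ?h'\<bar> \<le> max A1 A2 * real n powr (3 / 2)"
      using \<open>?h' \<le> ?h\<close> \<open>?h \<le> ?h' + card D\<close> by linarith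
    obtain c where c: "\<forall>x\<in>V. c x < k"
      "card (mono_edges E V c) \<le> A2 * (real (card V) ^ 2 / real k ^ (r + 1))"
      using colouring_few_mono_edges[OF edges free assms w_def V k] unfolding A2_def by blast
    have "?h \<le> card (mono_edges E V c)" unfolding G(4) using G(1) k c(1) by (intro h_graph_le_mono_edges) auto
    then have "real ?h \<le> A2 * (real n ^ 2 / real k ^ (r + 1))" using c(2) unfolding G(2) by linarith
    also have "\<dots> \<le> max A1 A2 * (real n ^ 2 / real k ^ (r + 1))" by (intro mult_right_mono) auto
    finally have "real ?h \<le> max A1 A2 * (real n ^ 2 / real k ^ (r + 1))" .
    with diff show "\<bar>real ?h - real ?h'\<bar> \<le> max A1 A2 * real n powr (3 / 2) \<and>
      real ?h \<le> max A1 A2 * (real n ^ 2 / real k ^ (r + 1))" by blast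
  qed
qed

end
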